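(* For every $n\geq 0$ the hypersurface $$(x_1^2+x_2^2)(x_3^2+x_4^2)\cdots(x_{2n+1}^2+x_{2n+2}^2)=1$$ in $\mathbb{R}^{2n+2}$ is, after a suitable affine transformation of $\mathbb{R}^{2n+2}$, a $J$-tangent affine hypersphere.
   Context: $J$ is the standard complex structure on $\mathbb{R}^{2n+2}\cong\mathbb{C}^{n+1}$: $J(x_1,\ldots,x_{2n+2})=(-x_{n+2},\ldots,-x_{2n+2},x_1,\ldots,x_{n+1})$. For an immersion $f\colon M^{N}\to\mathbb{R}^{N+1}$ with transversal field $C$, the objects $\nabla,h,S,\tau$ are defined by $\mathrm{D}_Xf_*Y=f_*(\nabla_XY)+h(X,Y)C$, $\mathrm{D}_XC=-f_*(SX)+\tau(X)C$, with $\mathrm{D}$ the flat connection. $f$ is nondegenerate if $h$ is. For nondegenerate $f$ the affine normal (Blaschke) field is the transversal field $C$, unique up to sign, such that the metric volume form $\omega_h(X_1,\ldots,X_N)=|\det[h(X_i,X_j)]|^{1/2}$ (bases positively oriented with respect to $\Theta$) is $\nabla$-parallel and equals $\Theta(X_1,\ldots,X_N)=\det[f_*X_1,\ldots,f_*X_N,C]$. With this $C$, $f$ is an affine hypersphere if $S=\lambda I$, $\lambda$ constant. An affine hypersphere in $\mathbb{R}^{2n+2}$ is $J$-tangent if its Blaschke field satisfies $JC_x\in f_*(T_xM)$ for all $x\in M$. *)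

theory Defs
  imports "HOL-Analysis.Analysis" "Jordan_Normal_Form.Determinant"
begin

no_notation vec_index (infixl "$" 100)

text \<open>
  Smoothness. The definition of \<open>Ck_on\<close> is meant for open sets; a map on an arbitrary set is
  smooth if it locally extends to a smooth map on an open set.
\<close>

primrec Ck_on ::
  "nat \<Rightarrow> 'a::euclidean_space set \<Rightarrow> ('a \<Rightarrow> 'b::euclidean_space) \<Rightarrow> bool" where
  "Ck_on 0 U g \<longleftrightarrow> continuous_on U g"
| "Ck_on (Suc k) U g \<longleftrightarrow>
     g differentiable_on U \<and> (\<forall>v. Ck_on k U (\<lambda>p. frechet_derivative g (at p) v))"

definition smooth_open :: "'a::euclidean_space set \<Rightarrow> ('a \<Rightarrow> 'b::euclidean_space) \<Rightarrow> bool" where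
  "smooth_open U g \<longleftrightarrow> open U \<and> (\<forall>k. Ck_on k U g)"

definition smooth_map :: "'a::euclidean_space set \<Rightarrow> ('a \<Rightarrow> 'b::euclidean_space) \<Rightarrow> bool" where
  "smooth_map M g \<longleftrightarrow>
     (\<forall>p\<in>M. \<exists>W G. p \<in> W \<and> smooth_open W G \<and> (\<forall>q\<in>M \<inter> W. G q = g q))"

text \<open>
  Manifolds are embedded submanifolds of a Euclidean space, given by slice charts.
\<close>

definition submanifold :: "nat \<Rightarrow> 'a::euclidean_space set \<Rightarrow> bool" where
  "submanifold N M \<longleftrightarrow>
     (\<forall>p\<in>M. \<exists>W V \<phi> \<psi> E.
        p \<in> W \<and> smooth_open W \<phi> \<and> smooth_open V (\<psi> :: 'a \<Rightarrow> 'a) \<and> homeomorphism W V \<phi> \<psi> \<and>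
        subspace E \<and> dim E = N \<and> \<phi> ` (W \<inter> M) = V \<inter> E)"

definition tangent_space :: "'a::euclidean_space set \<Rightarrow> 'a \<Rightarrow> 'a set" where
  "tangent_space M p =
     {v. \<exists>\<epsilon>>0. \<exists>\<gamma> :: real \<Rightarrow> 'a. smooth_open {-\<epsilon><..<\<epsilon>} \<gamma> \<and> \<gamma> ` {-\<epsilon><..<\<epsilon>} \<subseteq> M \<and>
           \<gamma> 0 = p \<and> (\<gamma> has_vector_derivative v) (at 0)}"

definition vector_field :: "'a::euclidean_space set \<Rightarrow> ('a \<Rightarrow> 'a) \<Rightarrow> bool" where
  "vector_field M X \<longleftrightarrow> smooth_map M X \<and> (\<forall>p\<in>M. X p \<in> tangent_space M p)"

text \<open>
  The differential at \<open>p\<close> of a map on \<open>M\<close>. A derivative within \<open>M\<close> need not be unique as a linear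
  map on the ambient space, but its values on \<open>tangent_space M p\<close> are, and it is only ever applied
  to tangent vectors. For a map \<open>f\<close> into \<open>\<real>\<^sup>N\<^sup>+\<^sup>1\<close>, \<open>Dflat M X f\<close> is thus the field \<open>f\<^sub>* X\<close> along \<open>f\<close>, and
  for a field \<open>C\<close> along \<open>f\<close>, \<open>Dflat M X C\<close> is its flat covariant derivative.
\<close>

definition pushforward ::
  "'a::euclidean_space set \<Rightarrow> ('a \<Rightarrow> 'b::euclidean_space) \<Rightarrow> 'a \<Rightarrow> 'a \<Rightarrow> 'b" where
  "pushforward M f p = frechet_derivative f (at p within M)"

definition Dflat ::
  "'a::euclidean_space set \<Rightarrow> ('a \<Rightarrow> 'a) \<Rightarrow> ('a \<Rightarrow> 'b::euclidean_space) \<Rightarrow> 'a \<Rightarrow> 'b" where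
  "Dflat M X g p = pushforward M g p (X p)"

definition hypersurface_immersion ::
  "'a::euclidean_space set \<Rightarrow> ('a \<Rightarrow> real ^ 'd::finite) \<Rightarrow> bool" where
  "hypersurface_immersion M f \<longleftrightarrow>
     submanifold (CARD('d) - 1) M \<and> smooth_map M f \<and>
     (\<forall>p\<in>M. inj_on (pushforward M f p) (tangent_space M p))"

definition transversal_field ::
  "'a::euclidean_space set \<Rightarrow> ('a \<Rightarrow> real ^ 'd::finite) \<Rightarrow> ('a \<Rightarrow> real ^ 'd) \<Rightarrow> bool" where
  "transversal_field M f C \<longleftrightarrow>
     smooth_map M C \<and> (\<forall>p\<in>M. C p \<notin> pushforward M f p ` tangent_space M p)"

text \<open>
  The components of the Gauss formula \<open>D\<^sub>X f\<^sub>* Y = f\<^sub>* (\<nabla>\<^sub>X Y) + h(X,Y) C\<close> and of the Weingarten formula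
  \<open>D\<^sub>X C = - f\<^sub>* (S X) + \<tau>(X) C\<close>.
\<close>

definition induced_connection ::
  "'a::euclidean_space set \<Rightarrow> ('a \<Rightarrow> real ^ 'd::finite) \<Rightarrow> ('a \<Rightarrow> real ^ 'd) \<Rightarrow>
   ('a \<Rightarrow> 'a) \<Rightarrow> ('a \<Rightarrow> 'a) \<Rightarrow> 'a \<Rightarrow> 'a" where
  "induced_connection M f C X Y p =
     (THE Z. Z \<in> tangent_space M p \<and>
        (\<exists>a. Dflat M X (Dflat M Y f) p = pushforward M f p Z + a *\<^sub>R C p))"

definition second_fundamental_form ::
  "'a::euclidean_space set \<Rightarrow> ('a \<Rightarrow> real ^ 'd::finite) \<Rightarrow> ('a \<Rightarrow> real ^ 'd) \<Rightarrow>
   ('a \<Rightarrow> 'a) \<Rightarrow> ('a \<Rightarrow> 'a) \<Rightarrow> 'a \<Rightarrow> real" where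
  "second_fundamental_form M f C X Y p =
     (THE a. \<exists>Z \<in> tangent_space M p.
        Dflat M X (Dflat M Y f) p = pushforward M f p Z + a *\<^sub>R C p)"

definition shape_operator ::
  "'a::euclidean_space set \<Rightarrow> ('a \<Rightarrow> real ^ 'd::finite) \<Rightarrow> ('a \<Rightarrow> real ^ 'd) \<Rightarrow>
   ('a \<Rightarrow> 'a) \<Rightarrow> 'a \<Rightarrow> 'a" where
  "shape_operator M f C X p =
     (THE Z. Z \<in> tangent_space M p \<and>
        (\<exists>\<tau>. Dflat M X C p = - pushforward M f p Z + \<tau> *\<^sub>R C p))"

definition transversal_connection_form ::
  "'a::euclidean_space set \<Rightarrow> ('a \<Rightarrow> real ^ 'd::finite) \<Rightarrow> ('a \<Rightarrow> real ^ 'd) \<Rightarrow>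
   ('a \<Rightarrow> 'a) \<Rightarrow> 'a \<Rightarrow> real" where
  "transversal_connection_form M f C X p =
     (THE \<tau>. \<exists>Z \<in> tangent_space M p. Dflat M X C p = - pushforward M f p Z + \<tau> *\<^sub>R C p)"

definition nondegenerate ::
  "'a::euclidean_space set \<Rightarrow> ('a \<Rightarrow> real ^ 'd::finite) \<Rightarrow> ('a \<Rightarrow> real ^ 'd) \<Rightarrow> bool" where
  "nondegenerate M f C \<longleftrightarrow>
     (\<forall>p\<in>M. \<forall>X. vector_field M X \<longrightarrow>
        (\<forall>Y. vector_field M Y \<longrightarrow> second_fundamental_form M f C X Y p = 0) \<longrightarrow> X p = 0)"

text \<open>
  In what follows \<open>e\<close> enumerates the coordinates: \<open>x\<^sub>i = x $ e i\<close> for \<open>1 \<le> i \<le> CARD('d)\<close>. Tuples of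
  vector fields \<open>X\<^sub>1, \<dots>, X\<^sub>N\<close>, where \<open>N = CARD('d) - 1\<close>, are written \<open>Xs 0, \<dots>, Xs (N - 1)\<close>.
\<close>

definition Theta_form ::
  "(nat \<Rightarrow> 'd) \<Rightarrow> 'a::euclidean_space set \<Rightarrow> ('a \<Rightarrow> real ^ 'd::finite) \<Rightarrow> ('a \<Rightarrow> real ^ 'd) \<Rightarrow>
   (nat \<Rightarrow> 'a \<Rightarrow> 'a) \<Rightarrow> 'a \<Rightarrow> real" where
  "Theta_form e M f C Xs p =
     Determinant.det (Matrix.mat CARD('d) CARD('d)
       (\<lambda>(i, j). (if j < CARD('d) - 1 then Dflat M (Xs j) f p else C p) $ e (Suc i)))"

text \<open>
  The metric volume form is \<open>|det [h(X\<^sub>i,X\<^sub>j)]|\<^sup>1\<^sup>/\<^sup>2\<close> on bases that are positively oriented with respect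
  to \<open>Theta_form\<close>; being alternating, it has the opposite sign on negatively oriented bases and
  vanishes on dependent tuples, which accounts for the factor \<open>sgn\<close>.
\<close>

definition metric_volume_form ::
  "(nat \<Rightarrow> 'd) \<Rightarrow> 'a::euclidean_space set \<Rightarrow> ('a \<Rightarrow> real ^ 'd::finite) \<Rightarrow> ('a \<Rightarrow> real ^ 'd) \<Rightarrow>
   (nat \<Rightarrow> 'a \<Rightarrow> 'a) \<Rightarrow> 'a \<Rightarrow> real" where
  "metric_volume_form e M f C Xs p =
     sgn (Theta_form e M f C Xs p) *
     sqrt \<bar>Determinant.det (Matrix.mat (CARD('d) - 1) (CARD('d) - 1)
       (\<lambda>(i, j). second_fundamental_form M f C (Xs i) (Xs j) p))\<bar>"

text \<open>\<open>(\<nabla>\<^sub>X \<omega>)(X\<^sub>1,\<dots>,X\<^sub>N) = X(\<omega>(X\<^sub>1,\<dots>,X\<^sub>N)) - \<Sum>\<^sub>i \<omega>(X\<^sub>1,\<dots>,\<nabla>\<^sub>X X\<^sub>i,\<dots>,X\<^sub>N) = 0\<close>\<close>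

definition parallel_form ::
  "nat \<Rightarrow> 'a::euclidean_space set \<Rightarrow> (('a \<Rightarrow> 'a) \<Rightarrow> ('a \<Rightarrow> 'a) \<Rightarrow> 'a \<Rightarrow> 'a) \<Rightarrow>
   ((nat \<Rightarrow> 'a \<Rightarrow> 'a) \<Rightarrow> 'a \<Rightarrow> real) \<Rightarrow> bool" where
  "parallel_form N M nab \<omega> \<longleftrightarrow>
     (\<forall>X Xs. vector_field M X \<longrightarrow> (\<forall>i<N. vector_field M (Xs i)) \<longrightarrow>
        (\<forall>p\<in>M. Dflat M X (\<omega> Xs) p - (\<Sum>i<N. \<omega> (Xs(i := nab X (Xs i))) p) = 0))"

definition Blaschke_field ::
  "(nat \<Rightarrow> 'd) \<Rightarrow> 'a::euclidean_space set \<Rightarrow> ('a \<Rightarrow> real ^ 'd::finite) \<Rightarrow> ('a \<Rightarrow> real ^ 'd) \<Rightarrow> bool"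
  where
  "Blaschke_field e M f C \<longleftrightarrow>
     transversal_field M f C \<and> nondegenerate M f C \<and>
     parallel_form (CARD('d) - 1) M (induced_connection M f C) (metric_volume_form e M f C) \<and>
     (\<forall>Xs. (\<forall>i < CARD('d) - 1. vector_field M (Xs i)) \<longrightarrow>
        (\<forall>p\<in>M. metric_volume_form e M f C Xs p = Theta_form e M f C Xs p))"

definition affine_hypersphere_wrt ::
  "(nat \<Rightarrow> 'd) \<Rightarrow> 'a::euclidean_space set \<Rightarrow> ('a \<Rightarrow> real ^ 'd::finite) \<Rightarrow> ('a \<Rightarrow> real ^ 'd) \<Rightarrow> bool"
  where
  "affine_hypersphere_wrt e M f C \<longleftrightarrow>
     hypersurface_immersion M f \<and> Blaschke_field e M f C \<and>
     (\<exists>c. \<forall>X. vector_field M X \<longrightarrow> (\<forall>p\<in>M. shape_operator M f C X p = c *\<^sub>R X p))"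

text \<open>
  \<open>J (x\<^sub>1, \<dots>, x\<^sub>2\<^sub>m) = (- x\<^sub>m\<^sub>+\<^sub>1, \<dots>, - x\<^sub>2\<^sub>m, x\<^sub>1, \<dots>, x\<^sub>m)\<close>, where \<open>2 * m = CARD('d)\<close>.
\<close>

definition complex_structure :: "(nat \<Rightarrow> 'd) \<Rightarrow> real ^ 'd::finite \<Rightarrow> real ^ 'd" where
  "complex_structure e x =
     (\<chi> k. let m = CARD('d) div 2; i = inv_into {1..CARD('d)} e k in
            if i \<le> m then - (x $ e (i + m)) else x $ e (i - m))"

definition J_tangent_affine_hypersphere ::
  "(nat \<Rightarrow> 'd) \<Rightarrow> 'a::euclidean_space set \<Rightarrow> ('a \<Rightarrow> real ^ 'd::finite) \<Rightarrow> bool" where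
  "J_tangent_affine_hypersphere e M f \<longleftrightarrow>
     (\<exists>C. affine_hypersphere_wrt e M f C \<and>
        (\<forall>p\<in>M. complex_structure e (C p) \<in> pushforward M f p ` tangent_space M p))"

end

theory Submission
  imports Defs
begin

text \<open>
  Grouping the coordinates into complex numbers \<open>z\<^sub>k = x\<^sub>k + i x\<^sub>k\<^sub>+\<^sub>m\<close>, where \<open>m = n + 1\<close>, turns the hypersurface
  into \<open>\<bar>z\<^sub>1\<bar>\<^sup>2 \<cdots> \<bar>z\<^sub>m\<bar>\<^sup>2 = 1\<close>. In logarithmic coordinates it is the hyperplane \<open>\<Sum> Re w\<^sub>k = 0\<close>; its tangent
  space at \<open>z\<close> consists of the \<open>v\<close> with \<open>\<Sum> Re (v\<^sub>k / z\<^sub>k) = 0\<close>. With the transversal field \<open>C = s z\<close>,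
  differentiating this equation gives \<open>h(X,Y) = \<Sum> Re (X\<^sub>k Y\<^sub>k / z\<^sub>k\<^sup>2) / (m s)\<close>. The bilinear form \<open>m s h\<close> extends to
  the ambient space, has determinant \<open>\<plusminus>1\<close> there because \<open>\<Prod> \<bar>z\<^sub>k\<bar> = 1\<close>, and makes \<open>C\<close> orthogonal to
  the tangent space, so comparing Gram determinants yields
  \<open>\<Theta>\<^sup>2 = s\<^sup>2\<^sup>m\<^sup>+\<^sup>1 m\<^sup>2\<^sup>m \<bar>det h\<bar>\<close>, which fixes \<open>s\<close>. As \<open>D\<^sub>X C = s X\<close> is tangential, \<open>\<Theta>\<close> is parallel and
  \<open>S = - s I\<close>. Finally \<open>J C = i s z\<close> is tangential because \<open>Re (i s) = 0\<close>.
\<close>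

section \<open>Smooth maps and tangential fields\<close>

lemma Ck_on_cong:
  fixes f g :: "'a::euclidean_space \<Rightarrow> 'b::euclidean_space"
  assumes "open U" "\<And>x. x \<in> U \<Longrightarrow> f x = g x"
  shows "Ck_on k U f \<longleftrightarrow> Ck_on k U g"
  using assms(2)
proof (induction k arbitrary: f g)
  case 0
  then show ?case by (simp cong: continuous_on_cong)
next
  case (Suc k)
  have der: "(f has_derivative D) (at x) \<longleftrightarrow> (g has_derivative D) (at x)" if "x \<in> U" for x D
    using has_derivative_transform_within_open[OF _ assms(1) that] Suc.prems by metis
  have "frechet_derivative f (at x) = frechet_derivative g (at x)" if "x \<in> U" for x
    using der[OF that] by (simp add: frechet_derivative_def)
  then have "Ck_on k U (\<lambda>p. frechet_derivative f (at p) v) \<longleftrightarrow>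
      Ck_on k U (\<lambda>p. frechet_derivative g (at p) v)" for v
    by (intro Suc.IH) simp
  moreover have "f differentiable_on U \<longleftrightarrow> g differentiable_on U"
    using der by (auto simp: differentiable_on_def differentiable_def at_within_open[OF _ assms(1)])
  ultimately show ?case by simp
qed

text \<open>Replaces the choice-defined \<open>frechet_derivative\<close> by a derivative
  \<open>D\<close> known in closed form; \<open>Ck_on_cong\<close> carries the remaining orders
  across.\<close>

lemma Ck_on_SucI:
  fixes g :: "'a::euclidean_space \<Rightarrow> 'b::euclidean_space"
  assumes "open U"
    and D: "\<And>x. x \<in> U \<Longrightarrow> (g has_derivative D x) (at x)"
    and k: "\<And>v. Ck_on k U (\<lambda>x. D x v)"
  shows "Ck_on (Suc k) U g"
proof -
  have "g differentiable_on U"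
    using D by (meson differentiableI differentiable_at_withinI differentiable_on_def)
  moreover have "Ck_on k U (\<lambda>p. frechet_derivative g (at p) v)" for v
  proof (subst Ck_on_cong[OF \<open>open U\<close>])
    show "frechet_derivative g (at x) v = D x v" if "x \<in> U" for x
      using frechet_derivative_at[OF D[OF that]] by simp
  qed (rule k)
  ultimately show ?thesis by simp
qed

lemma smooth_openI:
  fixes g :: "'a::euclidean_space \<Rightarrow> 'b::euclidean_space"
  assumes "open U"
    and D: "\<And>x. x \<in> U \<Longrightarrow> (g has_derivative D x) (at x)"
    and S: "\<And>v. smooth_open U (\<lambda>x. D x v)"
  shows "smooth_open U g"
proof -
  have "Ck_on k U g" for k
  proof (cases k)
    case 0
    have "isCont g x" if "x \<in> U" for x
      using D[OF that] by (rule has_derivative_continuous)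
    then show ?thesis using 0 by (simp add: continuous_at_imp_continuous_on)
  next
    case (Suc j)
    have "Ck_on j U (\<lambda>x. D x v)" for v
      using S[of v] unfolding smooth_open_def by blast
    from Ck_on_SucI[OF \<open>open U\<close> D this] show ?thesis unfolding Suc .
  qed
  with \<open>open U\<close> show ?thesis unfolding smooth_open_def by blast
qed

text \<open>Induction on the order over all members of \<open>F\<close> at once: a directional
  derivative of a member is again a member. A smoothness proof thus reduces to one differentiation
  formula for a closed family.\<close>

lemma smooth_open_family:
  fixes g :: "'a::euclidean_space \<Rightarrow> 'b::euclidean_space"
  assumes "open U" "g \<in> F"
    and D: "\<And>g x. g \<in> F \<Longrightarrow> x \<in> U \<Longrightarrow> (g has_derivative D g x) (at x)"
    and F: "\<And>g v. g \<in> F \<Longrightarrow> (\<lambda>x. D g x v) \<in> F"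
  shows "smooth_open U g"
proof -
  have "Ck_on k U g" for k
    using \<open>g \<in> F\<close>
  proof (induction k arbitrary: g)
    case 0
    have "isCont g x" if "x \<in> U" for x
      using D[OF 0 that] by (rule has_derivative_continuous)
    then show ?case by (simp add: continuous_at_imp_continuous_on)
  next
    case (Suc k)
    show ?case
      by (rule Ck_on_SucI[OF \<open>open U\<close> D[OF Suc.prems] Suc.IH[OF F[OF Suc.prems]]])
  qed
  with \<open>open U\<close> show ?thesis by (simp add: smooth_open_def)
qed

lemma smooth_open_linear:
  fixes g :: "'a::euclidean_space \<Rightarrow> 'b::euclidean_space"
  assumes "linear g"
  shows "smooth_open UNIV g"
proof (rule smooth_open_family)
  let ?F = "{g :: 'a \<Rightarrow> 'b. linear g} \<union> range (\<lambda>c x. c)"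
  \<comment> \<open>The zero map is both linear and constant; the first branch gives it derivative
    zero, in agreement with the second.\<close>
  define D where "D = (\<lambda>(g :: 'a \<Rightarrow> 'b) (x :: 'a). if linear g then g else (\<lambda>v. 0))"
  show "g \<in> ?F" using assms by simp
  show "(g has_derivative D g x) (at x)" if "g \<in> ?F" for g x
    using that by (auto simp: D_def linear_imp_has_derivative)
  show "(\<lambda>x. D g x v) \<in> ?F" for g v
    by (auto simp: D_def)
qed simp

lemma smooth_open_subset:
  fixes g :: "'a::euclidean_space \<Rightarrow> 'b::euclidean_space"
  assumes "smooth_open U g" "open V" "V \<subseteq> U"
  shows "smooth_open V g"
proof -
  have "Ck_on k U g \<Longrightarrow> Ck_on k V g" for k and g :: "'a \<Rightarrow> 'b"
    using assms(3)
    by (induction k arbitrary: g) (auto intro: continuous_on_subset differentiable_on_subset)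
  with assms(1,2) show ?thesis unfolding smooth_open_def by blast
qed

lemma smooth_map_linear:
  fixes g :: "'a::euclidean_space \<Rightarrow> 'b::euclidean_space"
  assumes "linear g"
  shows "smooth_map M g"
  using smooth_open_linear[OF assms] unfolding smooth_map_def by blast

section \<open>Derivatives within a subset and tangent vectors\<close>

lemma smooth_open_has_derivative:
  assumes "smooth_open W G" "x \<in> W"
  shows "(G has_derivative frechet_derivative G (at x)) (at x)"
proof -
  have "Ck_on (Suc 0) W G" "open W" using assms(1) unfolding smooth_open_def by blast+
  then have "G differentiable (at x)"
    using assms(2) by (metis Ck_on.simps(2) differentiable_on_def at_within_open)
  then show ?thesis by (simp add: frechet_derivative_works)
qed

lemma smooth_open_imp_continuous_on:
  assumes "smooth_open W G"
  shows "continuous_on W G"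
proof -
  have "Ck_on 0 W G" using assms unfolding smooth_open_def by blast
  then show ?thesis by simp
qed

lemma smooth_open_frechet_differentiable:
  assumes "smooth_open W G" "x \<in> W"
  shows "(\<lambda>q. frechet_derivative G (at q) v) differentiable (at x)"
proof -
  have "Ck_on (Suc (Suc 0)) W G" "open W" using assms(1) unfolding smooth_open_def by blast+
  then show ?thesis
    using assms(2) by (metis Ck_on.simps(2) differentiable_on_def at_within_open)
qed

text \<open>The filter \<open>at p within M\<close> sees only points of \<open>M\<close> near
  \<open>p\<close>, where the local extension \<open>G\<close> and \<open>g\<close> agree.\<close>

lemma has_derivative_within_local_transform:
  assumes "(G has_derivative D) (at p)" "open W" "p \<in> W" "p \<in> M" "\<And>q. q \<in> M \<inter> W \<Longrightarrow> G q = g q"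
  shows "(g has_derivative D) (at p within M)"
proof -
  have "(g has_derivative D) (at p within M \<inter> W)"
    using has_derivative_transform[of p "M \<inter> W" g G D] has_derivative_at_withinI[OF assms(1)] assms
    by simp
  moreover have "at p within M \<inter> W = at p within M"
    using assms by (intro at_within_nhd[of p W]) auto
  ultimately show ?thesis by simp
qed

lemma smooth_map_differentiable:
  assumes "smooth_map M g" "p \<in> M"
  shows "g differentiable (at p within M)"
proof -
  obtain W G where W: "p \<in> W" "smooth_open W G" "\<forall>q\<in>M \<inter> W. G q = g q"
    using assms unfolding smooth_map_def by blast
  have "open W" using W(2) unfolding smooth_open_def by blast
  then have "(g has_derivative frechet_derivative G (at p)) (at p within M)"
    by (rule has_derivative_within_local_transform[OF smooth_open_has_derivative[OF W(2,1)]])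
      (use W assms(2) in auto)
  then show ?thesis by (rule differentiableI)
qed

text \<open>Tangent vectors are velocities of curves in \<open>M\<close>, so the chain rule determines any derivative
  within \<open>M\<close> on them.\<close>

lemma pushforward_eq:
  assumes g: "(g has_derivative D) (at p within M)" and v: "v \<in> tangent_space M p"
  shows "pushforward M g p v = D v"
proof -
  obtain \<epsilon> \<gamma> where \<epsilon>: "\<epsilon> > 0" and M: "\<gamma> ` {-\<epsilon><..<\<epsilon>} \<subseteq> M" and p: "\<gamma> 0 = p"
    and \<gamma>: "(\<gamma> has_vector_derivative v) (at 0)"
    using v unfolding tangent_space_def by blast
  have *: "(g \<circ> \<gamma> has_vector_derivative D' v) (at 0)" if "(g has_derivative D') (at p within M)" for D'
  proof -
    have "(g has_derivative D') (at (\<gamma> 0) within \<gamma> ` {-\<epsilon><..<\<epsilon>})"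
      using has_derivative_subset[OF that M] p by simp
    then have "(g \<circ> \<gamma> has_vector_derivative D' v) (at 0 within {-\<epsilon><..<\<epsilon>})"
      by (rule vector_derivative_diff_chain_within[OF has_vector_derivative_at_within[OF \<gamma>]])
    then show ?thesis using \<epsilon> by (simp add: at_within_open[of 0 "{-\<epsilon><..<\<epsilon>}"])
  qed
  have "(g has_derivative pushforward M g p) (at p within M)"
    using differentiableI[OF g] by (simp add: pushforward_def flip: frechet_derivative_works)
  from vector_derivative_unique_at[OF *[OF this] *[OF g]] show ?thesis .
qed

lemma pushforward_id: "v \<in> tangent_space M p \<Longrightarrow> pushforward M (\<lambda>x. x) p v = v"
  by (rule pushforward_eq[OF has_derivative_ident])

lemma tangent_spaceI:
  assumes "smooth_open UNIV \<gamma>" "\<And>t :: real. \<gamma> t \<in> M" "\<gamma> 0 = p" "(\<gamma> has_vector_derivative v) (at 0)"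
  shows "v \<in> tangent_space M p"
proof -
  have "smooth_open {-1<..<1} \<gamma>" by (rule smooth_open_subset[OF assms(1)]) auto
  with assms(2-4) show ?thesis
    unfolding tangent_space_def by (intro CollectI exI[of _ 1] exI[of _ \<gamma>]) auto
qed

text \<open>Reduces the homeomorphism and the slice equation to pointwise checks; continuity of both
  maps comes from their smoothness.\<close>

lemma slice_chartI:
  fixes \<phi> :: "'a::euclidean_space \<Rightarrow> 'a"
  assumes "p \<in> W" "smooth_open W \<phi>" "smooth_open V \<psi>" "subspace E" "dim E = N"
    and \<phi>: "\<And>x. x \<in> W \<Longrightarrow> \<phi> x \<in> V" "\<And>x. x \<in> W \<Longrightarrow> \<psi> (\<phi> x) = x" "\<And>x. x \<in> W \<Longrightarrow> x \<in> M \<Longrightarrow> \<phi> x \<in> E"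
    and \<psi>: "\<And>w. w \<in> V \<Longrightarrow> \<psi> w \<in> W" "\<And>w. w \<in> V \<Longrightarrow> \<phi> (\<psi> w) = w" "\<And>w. w \<in> V \<Longrightarrow> w \<in> E \<Longrightarrow> \<psi> w \<in> M"
  shows "\<exists>W V \<phi> \<psi> E. p \<in> W \<and> smooth_open W \<phi> \<and> smooth_open V (\<psi> :: 'a \<Rightarrow> 'a) \<and>
      homeomorphism W V \<phi> \<psi> \<and> subspace E \<and> dim E = N \<and> \<phi> ` (W \<inter> M) = V \<inter> E"
proof -
  have "homeomorphism W V \<phi> \<psi>"
    using \<phi>(1,2) \<psi>(1,2) assms(2,3)
    by (intro homeomorphismI) (auto intro: smooth_open_imp_continuous_on)
  moreover have "\<phi> ` (W \<inter> M) = V \<inter> E"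
  proof (intro equalityI subsetI)
    show "w \<in> \<phi> ` (W \<inter> M)" if "w \<in> V \<inter> E" for w
      using \<psi>[of w] that by (intro image_eqI[of _ _ "\<psi> w"]) auto
  qed (use \<phi> in auto)
  ultimately show ?thesis using assms(1-5) by blast
qed

text \<open>Tangential fields need not be smooth here: the induced connection of two smooth fields is only
  shown to be differentiable.\<close>

definition diff_field :: "'a::euclidean_space set \<Rightarrow> ('a \<Rightarrow> 'a) \<Rightarrow> bool" where
  "diff_field M X \<longleftrightarrow> (\<forall>p\<in>M. X p \<in> tangent_space M p \<and> X differentiable (at p within M))"

lemma vector_field_imp_diff_field: "vector_field M X \<Longrightarrow> diff_field M X"
  by (simp add: vector_field_def diff_field_def smooth_map_differentiable)

lemma Dflat_id: "diff_field M X \<Longrightarrow> p \<in> M \<Longrightarrow> Dflat M X (\<lambda>x. x) p = X p"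
  by (simp add: Dflat_def diff_field_def pushforward_id)

lemma Dflat_eq:
  assumes "(g has_derivative D) (at p within M)" "X p \<in> tangent_space M p"
  shows "Dflat M X g p = D (X p)"
  by (simp add: Dflat_def pushforward_eq[OF assms])

lemma has_derivative_cong_within:
  assumes "p \<in> M" "\<And>q. q \<in> M \<Longrightarrow> f q = g q"
  shows "(f has_derivative D) (at p within M) \<longleftrightarrow> (g has_derivative D) (at p within M)"
  using has_derivative_transform[OF assms(1), of f g D] has_derivative_transform[OF assms(1), of g f D]
    assms(2) by auto

text \<open>The choice in \<open>frechet_derivative\<close> is made from the same predicate for both
  maps, so the values agree even where no derivative exists.\<close>

lemma Dflat_cong:
  assumes "p \<in> M" "\<And>q. q \<in> M \<Longrightarrow> f q = g q"
  shows "Dflat M X f p = Dflat M X g p"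
  by (simp add: Dflat_def pushforward_def frechet_derivative_def has_derivative_cong_within[OF assms])

text \<open>For the inclusion, \<open>f_* Y\<close> is \<open>Y\<close> itself on \<open>M\<close>,
  so the left side of the Gauss formula is a first derivative of \<open>Y\<close>.\<close>

lemma Dflat_Dflat_id:
  assumes "diff_field M Y" "p \<in> M"
  shows "Dflat M X (Dflat M Y (\<lambda>x. x)) p = Dflat M X Y p"
  using assms by (intro Dflat_cong) (auto simp: Dflat_id)

text \<open>The metric volume form is evaluated on tuples containing \<open>\<nabla>_X X_i\<close>.
  The Gauss formula for such a field differentiates it once more, so \<open>D_X Y\<close> has to be
  differentiable.\<close>

lemma Dflat_differentiable:
  assumes X: "vector_field M X" and Y: "smooth_map M Y" and p: "p \<in> M"
  shows "Dflat M X Y differentiable (at p within M)"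
proof -
  obtain W G where W: "p \<in> W" "smooth_open W G" "\<forall>q\<in>M \<inter> W. G q = Y q"
    using p Y unfolding smooth_map_def by blast
  have oW: "open W" using W(2) unfolding smooth_open_def by blast
  \<comment> \<open>Expanding \<open>X q\<close> in the basis writes the derivative as coefficients
    of \<open>X\<close> times partial derivatives of \<open>G\<close>, each differentiable.\<close>
  define H where "H = (\<lambda>q. \<Sum>b\<in>Basis. inner (X q) b *\<^sub>R frechet_derivative G (at q) b)"
  have eq: "H q = Dflat M X Y q" if q: "q \<in> M \<inter> W" for q
  proof -
    have G: "(G has_derivative frechet_derivative G (at q)) (at q)"
      using smooth_open_has_derivative W q by blast
    have "(Y has_derivative frechet_derivative G (at q)) (at q within M)"
      by (rule has_derivative_within_local_transform[OF G oW]) (use W q in auto)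
    then have "Dflat M X Y q = frechet_derivative G (at q) (X q)"
      using X q by (intro Dflat_eq) (auto simp: vector_field_def)
    also have "\<dots> = H q"
      unfolding H_def by (subst euclidean_representation[of "X q", symmetric])
        (simp add: linear_sum[OF has_derivative_linear[OF G]] linear_scale[OF has_derivative_linear[OF G]])
    finally show ?thesis ..
  qed
  have "X differentiable (at p within M)"
    using X p by (simp add: vector_field_def smooth_map_differentiable)
  then have "H differentiable (at p within M)"
    unfolding H_def using smooth_open_frechet_differentiable[OF W(2,1)]
    by (intro differentiable_sum differentiable_scaleR ballI differentiable_inner)
      (auto intro: differentiable_at_withinI)
  then obtain D where "(H has_derivative D) (at p within M)"
    unfolding differentiable_def by blast
  then have "(H has_derivative D) (at p within M \<inter> W)"
    by (rule has_derivative_subset) auto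
  then have "(Dflat M X Y has_derivative D) (at p within M \<inter> W)"
    using has_derivative_transform[of p "M \<inter> W" "Dflat M X Y" H D] eq W(1) p by auto
  moreover have "at p within M \<inter> W = at p within M"
    using oW W(1) by (intro at_within_nhd[of p W]) auto
  ultimately show ?thesis by (auto intro: differentiableI)
qed

section \<open>Splitting a vector along a hyperplane and a transversal vector\<close>

text \<open>Applying \<open>F\<close> to the decomposition kills the part in \<open>T\<close> and
  leaves \<open>F w = a * F c\<close>. With \<open>F = logd p\<close> and
  \<open>c = blaschke p\<close> this evaluates the description defining \<open>h\<close>; the next
  two lemmas do the same for \<open>\<nabla>\<close> and \<open>S\<close>.\<close>

lemma the_transversal_component:
  fixes F :: "'a::real_vector \<Rightarrow> real"
  assumes F: "linear F" "F c \<noteq> 0" and T: "T = {v. F v = 0}"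
  shows "(THE a. \<exists>Z\<in>T. w = Z + a *\<^sub>R c) = F w / F c"
proof (rule the_equality)
  show "\<exists>Z\<in>T. w = Z + (F w / F c) *\<^sub>R c"
    using F by (intro bexI[of _ "w - (F w / F c) *\<^sub>R c"]) (simp_all add: T linear_diff linear_scale)
  show "a = F w / F c" if "\<exists>Z\<in>T. w = Z + a *\<^sub>R c" for a
    using that F by (auto simp: T linear_add linear_scale)
qed

lemma the_tangential_component:
  fixes F :: "'a::real_vector \<Rightarrow> real"
  assumes F: "linear F" "F c \<noteq> 0" and T: "T = {v. F v = 0}"
  shows "(THE Z. Z \<in> T \<and> (\<exists>a. w = Z + a *\<^sub>R c)) = w - (F w / F c) *\<^sub>R c"
proof (rule the_equality)
  show "w - (F w / F c) *\<^sub>R c \<in> T \<and> (\<exists>a. w = w - (F w / F c) *\<^sub>R c + a *\<^sub>R c)"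
    using F by (auto simp: T linear_diff linear_scale)
  show "Z = w - (F w / F c) *\<^sub>R c" if "Z \<in> T \<and> (\<exists>a. w = Z + a *\<^sub>R c)" for Z
    using that F by (auto simp: T linear_add linear_scale)
qed

lemma the_negative_tangential_component:
  fixes F :: "'a::real_vector \<Rightarrow> real"
  assumes F: "linear F" "F c \<noteq> 0" and T: "T = {v. F v = 0}"
  shows "(THE Z. Z \<in> T \<and> (\<exists>a. w = - Z + a *\<^sub>R c)) = (F w / F c) *\<^sub>R c - w"
proof (rule the_equality)
  show "(F w / F c) *\<^sub>R c - w \<in> T \<and> (\<exists>a. w = - ((F w / F c) *\<^sub>R c - w) + a *\<^sub>R c)"
    using F by (auto simp: T linear_diff linear_scale)
  show "Z = (F w / F c) *\<^sub>R c - w" if "Z \<in> T \<and> (\<exists>a. w = - Z + a *\<^sub>R c)" for Z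
    using that F by (auto simp: T linear_diff linear_scale)
qed

section \<open>Determinants\<close>

text \<open>\<open>c j i\<close> is the \<open>i\<close>-th entry of the \<open>j\<close>-th column.\<close>

definition cdet :: "nat \<Rightarrow> (nat \<Rightarrow> nat \<Rightarrow> real) \<Rightarrow> real" where
  "cdet n c = Determinant.det (Matrix.mat n n (\<lambda>(i, j). c j i))"

lemma cdet_eq:
  "cdet n c = (\<Sum>q | q permutes {0..<n}. signof q * (\<Prod>j<n. c j (q j)))"
  unfolding cdet_def
  by (subst det_col[of _ n]) (auto intro!: sum.cong prod.cong dest: permutes_in_image)

text \<open>Leibniz expansion with the factor from column \<open>k\<close> pulled out, which
  exhibits linearity in that column.\<close>

lemma cdet_upd:
  assumes "k < n"
  shows "cdet n (c(k := v)) = (\<Sum>q | q permutes {0..<n}. signof q * (v (q k) * (\<Prod>j\<in>{..<n}-{k}. c j (q j))))"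
proof -
  have "(\<Prod>j<n. (c(k := v)) j (q j)) = v (q k) * (\<Prod>j\<in>{..<n}-{k}. c j (q j))" for q :: "nat \<Rightarrow> nat"
    using assms by (subst prod.remove[of _ k]) (auto intro!: prod.cong)
  then show ?thesis by (simp add: cdet_eq)
qed

text \<open>Serves to discard the multiple of \<open>C\<close> by which
  \<open>\<nabla>_X X_k\<close> differs from \<open>D_X X_k\<close>, as \<open>C\<close> is itself a
  column.\<close>

lemma cdet_upd_add_scale:
  assumes k: "k < n" and l: "l < n" "k \<noteq> l"
  shows "cdet n (c(k := (\<lambda>i. v i + a * c l i))) = cdet n (c(k := v))"
proof -
  have "cdet n (c(k := c l)) = 0"
    unfolding cdet_def using k l
    by (intro det_identical_columns[of _ n k l]) (auto simp: col_def intro!: eq_vecI)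
  moreover have "cdet n (c(k := (\<lambda>i. v i + a * c l i))) = cdet n (c(k := v)) + a * cdet n (c(k := c l))"
    unfolding cdet_upd[OF k]
    by (simp add: algebra_simps sum.distrib sum_distrib_left)
  ultimately show ?thesis by simp
qed

text \<open>All columns are orthogonal to \<open>\<nu>\<close>, so \<open>\<nu>\<close> is a nonzero
  vector in the kernel of the transpose.\<close>

lemma cdet_eq_0:
  assumes "\<And>j. j < n \<Longrightarrow> (\<Sum>i<n. \<nu> i * c j i) = 0" "i < n" "\<nu> i \<noteq> 0"
  shows "cdet n c = 0"
proof -
  let ?A = "Matrix.mat n n (\<lambda>(i, j). c j i)"
  have "Determinant.det (transpose_mat ?A) = 0"
  proof (subst det_0_iff_vec_prod_zero[of _ n]; (intro exI[of _ "Matrix.vec n \<nu>"] conjI)?)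
    show "Matrix.vec n \<nu> \<noteq> 0\<^sub>v n" using assms(2,3) by (metis index_vec index_zero_vec(1))
    show "transpose_mat ?A *\<^sub>v Matrix.vec n \<nu> = 0\<^sub>v n"
      using assms(1) by (intro eq_vecI)
        (auto simp: scalar_prod_def atLeast0LessThan mult.commute intro!: sum.cong)
  qed auto
  then show ?thesis unfolding cdet_def by (subst (asm) det_transpose[of _ n]) auto
qed

text \<open>Product rule in each term of the Leibniz sum; exchanging the sums over columns and
  permutations collects one determinant per differentiated column.\<close>

lemma has_derivative_cdet:
  assumes "\<And>i j. i < n \<Longrightarrow> j < n \<Longrightarrow> ((\<lambda>x. c x j i) has_derivative (\<lambda>v. c' v j i)) (at p within S)"
  shows "((\<lambda>x. cdet n (c x)) has_derivative (\<lambda>v. \<Sum>k<n. cdet n ((c p)(k := c' v k)))) (at p within S)"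
proof -
  have eq: "(\<Sum>k<n. cdet n ((c p)(k := c' v k))) =
     (\<Sum>q | q permutes {0..<n}. signof q * (\<Sum>k<n. c' v k (q k) * (\<Prod>j\<in>{..<n}-{k}. c p j (q j))))" for v
    unfolding sum_distrib_left by (subst sum.swap) (auto intro!: sum.cong simp: cdet_upd)
  show ?thesis
    unfolding eq unfolding cdet_eq
  proof (intro has_derivative_sum has_derivative_mult_right has_derivative_prod)
    fix q j assume "q \<in> {q. q permutes {0..<n}}" "j \<in> {..<n}"
    then have "q j < n" "j < n" by (auto dest: permutes_in_image)
    then show "((\<lambda>x. c x j (q j)) has_derivative (\<lambda>v. c' v j (q j))) (at p within S)"
      by (rule assms)
  qed
qed

text \<open>The matrix factors as \<open>U^T K U\<close>, where \<open>U\<close> has the columns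
  \<open>c j\<close>.\<close>

lemma det_congruence:
  fixes K :: "real mat"
  assumes K: "K \<in> carrier_mat n n"
  shows "Determinant.det (Matrix.mat n n (\<lambda>(i, j). \<Sum>a<n. \<Sum>b<n. c i a * K $$ (a, b) * c j b)) =
    (cdet n c)\<^sup>2 * Determinant.det K"
proof -
  let ?U = "Matrix.mat n n (\<lambda>(i, j). c j i)"
  have "Matrix.mat n n (\<lambda>(i, j). \<Sum>a<n. \<Sum>b<n. c i a * K $$ (a, b) * c j b) = transpose_mat ?U * (K * ?U)"
    using K by (intro eq_matI) (auto simp: scalar_prod_def atLeast0LessThan sum_distrib_left mult.assoc)
  also have "Determinant.det \<dots> = Determinant.det ?U * (Determinant.det K * Determinant.det ?U)"
    using K det_transpose[of ?U n] by (simp add: det_mult[of _ n])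
  finally show ?thesis by (simp add: cdet_def power2_eq_square)
qed

text \<open>The last row vanishes off the diagonal, so the matrix is block upper triangular. It is
  applied to a Gram matrix whose last vector is orthogonal to the others.\<close>

lemma det_bordered:
  fixes G :: "nat \<Rightarrow> nat \<Rightarrow> real"
  assumes "\<And>j. j < n \<Longrightarrow> G n j = 0"
  shows "Determinant.det (Matrix.mat (Suc n) (Suc n) (\<lambda>(i, j). G i j)) =
    Determinant.det (Matrix.mat n n (\<lambda>(i, j). G i j)) * G n n"
proof -
  let ?A = "Matrix.mat n n (\<lambda>(i, j). G i j)" and ?B = "Matrix.mat n 1 (\<lambda>(i, j). G i n)"
  let ?D = "Matrix.mat 1 1 (\<lambda>(i, j). G n n)"
  have "Matrix.mat (Suc n) (Suc n) (\<lambda>(i, j). G i j) = four_block_mat ?A ?B (0\<^sub>m 1 n) ?D"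
    using assms by (intro eq_matI) (auto simp: less_Suc_eq)
  also have "Determinant.det \<dots> = Determinant.det ?A * Determinant.det ?D"
    by (rule det_four_block_mat_lower_left_zero[of _ n _ 1]) auto
  also have "Determinant.det ?D = G n n"
    by (simp add: det_def)
  finally show ?thesis .
qed

lemma det_mat_diag: "Determinant.det (mat_diag n f) = (\<Prod>i<n. f i)" for f :: "nat \<Rightarrow> real"
  by (subst det_upper_triangular[of _ n])
    (auto simp: mat_diag_def prod_list_diag_prod atLeast0LessThan intro!: prod.cong)

section \<open>Complex coordinates\<close>

text \<open>The pairing of the coordinates \<open>k\<close> and \<open>k + m\<close> is the one
  built into \<open>complex_structure\<close>; the first \<open>m\<close> indices carry the real
  parts.\<close>

locale split_coordinates =
  fixes e :: "nat \<Rightarrow> 'd::finite" and m :: nat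
  assumes bij_e: "bij_betw e {1..2 * m} (UNIV :: 'd set)"
begin

lemma card_d: "CARD('d) = 2 * m"
  using bij_betw_same_card[OF bij_e] by simp

lemma m_pos: "0 < m"
  using card_d zero_less_card_finite[where 'a='d] by simp

lemma inv_e: "i \<in> {1..2 * m} \<Longrightarrow> inv_into {1..2 * m} e (e i) = i"
  using bij_e by (simp add: bij_betw_def)

lemma sum_e: "(\<Sum>j\<in>UNIV. f j) = (\<Sum>k=1..m. f (e k) + f (e (k + m)))" for f :: "'d \<Rightarrow> 'b::comm_monoid_add"
proof -
  have "{1..2 * m} = {1..m} \<union> {1 + m..m + m}" by auto
  then have "(\<Sum>i=1..2 * m. f (e i)) = (\<Sum>k=1..m. f (e k)) + (\<Sum>i=1+m..m+m. f (e i))"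
    by (simp add: sum.union_disjoint)
  also have "(\<Sum>i=1+m..m+m. f (e i)) = (\<Sum>k=1..m. f (e (k + m)))"
    by (rule sum.shift_bounds_cl_nat_ivl)
  finally show ?thesis
    using sum.reindex_bij_betw[OF bij_e, of f] by (simp only: sum.distrib)
qed

definition zc :: "real ^ 'd \<Rightarrow> nat \<Rightarrow> complex" where
  "zc v k = Complex (v $ e k) (v $ e (k + m))"

text \<open>Inverse of \<open>zc\<close> on the indices from 1 to \<open>m\<close>; sequences that
  agree there give the same vector.\<close>

definition vc :: "(nat \<Rightarrow> complex) \<Rightarrow> real ^ 'd" where
  "vc a = (\<chi> j. let i = inv_into {1..2 * m} e j in if i \<le> m then Re (a i) else Im (a (i - m)))"

lemma vc_nth: "k \<in> {1..m} \<Longrightarrow> vc a $ e k = Re (a k)" "k \<in> {1..m} \<Longrightarrow> vc a $ e (k + m) = Im (a k)"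
  by (simp_all add: vc_def inv_e Let_def del: One_nat_def)

lemma zc_vc [simp]: "k \<in> {1..m} \<Longrightarrow> zc (vc a) k = a k"
  by (simp add: zc_def vc_nth complex_eq_iff)

lemma coordinate_cases:
  obtains k where "k \<in> {1..m}" "j = e k" | k where "k \<in> {1..m}" "j = e (k + m)"
proof -
  obtain i where i: "i \<in> {1..2 * m}" "j = e i"
    using bij_e by (metis UNIV_I bij_betw_iff_bijections)
  show thesis
  proof (cases "i \<le> m")
    case True
    with i that(1) show thesis by simp
  next
    case False
    with i have "i - m \<in> {1..m}" "j = e (i - m + m)" by auto
    then show thesis by (rule that(2))
  qed
qed

lemma vec_eqI:
  assumes "\<And>k. k \<in> {1..m} \<Longrightarrow> zc v k = zc w k"
  shows "v = w"
proof (rule iffD2[OF Finite_Cartesian_Product.vec_eq_iff], rule allI)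
  fix j show "v $ j = w $ j"
    by (rule coordinate_cases[of j]) (use assms in \<open>auto simp: zc_def\<close>)
qed

lemma vc_zc [simp]: "vc (zc v) = v"
  by (rule vec_eqI) simp

lemma vc_cong: "(\<And>k. k \<in> {1..m} \<Longrightarrow> a k = b k) \<Longrightarrow> vc a = vc b"
  by (rule vec_eqI) simp

lemma zc_linear [simp]:
  "zc (v + w) k = zc v k + zc w k" "zc (r *\<^sub>R v) k = r *\<^sub>R zc v k" "zc 0 k = 0"
  "zc (v - w) k = zc v k - zc w k" "zc (- v) k = - zc v k"
  by (simp_all add: zc_def complex_eq_iff)

lemma bounded_linear_zc: "bounded_linear (\<lambda>v. zc v k)"
  by (simp add: linear_conv_bounded_linear[symmetric] linearI)

lemmas has_derivative_zc [derivative_intros] = bounded_linear.has_derivative[OF bounded_linear_zc]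
lemmas continuous_on_zc [continuous_intros] = bounded_linear.continuous_on[OF bounded_linear_zc]

lemma linear_vc_comp:
  assumes "\<And>k. k \<in> {1..m} \<Longrightarrow> linear (\<lambda>v. f v k)"
  shows "linear (\<lambda>v. vc (f v))"
  by (intro linearI vec_eqI) (simp_all add: linear_add[OF assms] linear_scale[OF assms])

lemma has_derivative_vc:
  assumes "\<And>k. k \<in> {1..m} \<Longrightarrow> ((\<lambda>x. f x k) has_derivative (\<lambda>v. D v k)) (at p within S)"
  shows "((\<lambda>x. vc (f x)) has_derivative (\<lambda>v. vc (D v))) (at p within S)"
proof (subst has_derivative_componentwise_within, intro ballI)
  fix b :: "real ^ 'd" assume "b \<in> Basis"
  then obtain j where b: "b = axis j 1" by (auto simp: Basis_vec_def)
  have "((\<lambda>x. vc (f x) $ j) has_derivative (\<lambda>v. vc (D v) $ j)) (at p within S)"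
    by (rule coordinate_cases[of j])
      (use assms in \<open>auto simp: vc_nth intro: has_derivative_Re has_derivative_Im\<close>)
  then show "((\<lambda>x. inner (vc (f x)) b) has_derivative (\<lambda>v. inner (vc (D v)) b)) (at p within S)"
    by (simp add: b inner_axis)
qed

text \<open>The coordinates \<open>- x_(k+m)\<close> and \<open>x_k\<close> are the real and
  imaginary parts of \<open>\<i> z_k\<close>.\<close>

lemma complex_structure_eq: "complex_structure e x = vc (\<lambda>k. \<i> * zc x k)"
  by (rule vec_eqI)
    (simp add: complex_structure_def zc_def[of "\<chi> k. _ k"] card_d Let_def inv_e del: One_nat_def,
      simp add: zc_def complex_eq_iff)

section \<open>Smoothness of coordinatewise exponentials, quotients and logarithms\<close>

text \<open>Differentiating in direction \<open>v\<close> only multiplies the coefficient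
  \<open>a k\<close> by \<open>l v k\<close>, so the family over all \<open>a\<close> is closed. It
  contains the curves used for tangent vectors and the inverse charts.\<close>

lemma smooth_open_exp:
  fixes l :: "'a::euclidean_space \<Rightarrow> nat \<Rightarrow> complex"
  assumes "\<And>k. bounded_linear (\<lambda>x. l x k)"
  shows "smooth_open UNIV (\<lambda>x. vc (\<lambda>k. a k * exp (l x k)))"
proof (rule smooth_open_family)
  let ?F = "range (\<lambda>a (x :: 'a). vc (\<lambda>k. a k * exp (l x k)))"
  \<comment> \<open>For \<open>k\<close> from 1 to \<open>m\<close>, \<open>zc (g x) k\<close> is
    \<open>a k * exp (l x k)\<close> again, so the derivative is expressed through \<open>g\<close>
    without recovering \<open>a\<close>.\<close>
  let ?D = "\<lambda>g (x :: 'a) v. vc (\<lambda>k. zc (g x) k * l v k)"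
  show "(\<lambda>x. vc (\<lambda>k. a k * exp (l x k))) \<in> ?F" by blast
  show "(g has_derivative ?D g x) (at x)" if "g \<in> ?F" for g x
  proof -
    from that obtain a where g: "g = (\<lambda>x. vc (\<lambda>k. a k * exp (l x k)))" by blast
    have "((\<lambda>x. a k * exp (l x k)) has_derivative (\<lambda>v. a k * exp (l x k) * l v k)) (at x)" for k
    proof -
      have "((\<lambda>w. a k * exp w) has_derivative (\<lambda>h. a k * exp (l x k) * h)) (at (l x k))"
        by (rule has_field_derivative_imp_has_derivative) (auto intro!: derivative_eq_intros)
      from has_derivative_compose[OF bounded_linear.has_derivative[OF assms has_derivative_ident] this]
      show ?thesis .
    qed
    then have "(g has_derivative (\<lambda>v. vc (\<lambda>k. a k * exp (l x k) * l v k))) (at x)"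
      unfolding g by (rule has_derivative_vc)
    also have "(\<lambda>v. vc (\<lambda>k. a k * exp (l x k) * l v k)) = ?D g x"
      unfolding g by (intro ext vc_cong) simp
    finally show ?thesis .
  qed
  show "(\<lambda>x. ?D g x v) \<in> ?F" if "g \<in> ?F" for g v
  proof -
    from that obtain a where g: "g = (\<lambda>x. vc (\<lambda>k. a k * exp (l x k)))" by blast
    show ?thesis
      unfolding g by (intro range_eqI[where x = "\<lambda>k. a k * l v k"] ext vc_cong) simp
  qed
qed simp

text \<open>The derivative in direction \<open>v\<close> has coefficients \<open>- j a_k v_k\<close>
  and exponent \<open>j + 1\<close>, so the quotients with all coefficients and exponents form a
  closed family.\<close>

lemma smooth_open_ratio:
  assumes "open W" "\<And>x k. x \<in> W \<Longrightarrow> k \<in> {1..m} \<Longrightarrow> zc x k \<noteq> 0"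
  shows "smooth_open W (\<lambda>x. vc (\<lambda>k. a k / zc x k ^ j))"
proof -
  let ?f = "\<lambda>a j x. vc (\<lambda>k. a k / zc x k ^ j)"
  let ?F = "range (\<lambda>(a, j). ?f a j)"
  have "\<forall>g\<in>?F. \<exists>D. (\<forall>x\<in>W. (g has_derivative D x) (at x)) \<and> (\<forall>v. (\<lambda>x. D x v) \<in> ?F)"
  proof
    fix g assume "g \<in> ?F"
    then obtain a j where g: "g = ?f a j" by auto
    have "(g has_derivative (\<lambda>v. ?f (\<lambda>k. - of_nat j * a k * zc v k) (Suc j) x)) (at x)" if "x \<in> W" for x
      unfolding g
    proof (rule has_derivative_vc)
      fix k assume "k \<in> {1..m}"
      then have z: "zc x k \<noteq> 0" using assms(2) that by blast
      have "((\<lambda>w. a k / w ^ j) has_field_derivative - of_nat j * a k / zc x k ^ Suc j) (at (zc x k))"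
      proof (cases j)
        case (Suc i)
        show ?thesis unfolding Suc
          by (rule derivative_eq_intros refl)+ (use z in \<open>auto simp: field_simps\<close>)
      qed simp
      moreover have "(*) (- of_nat j * a k / zc x k ^ Suc j) = (\<lambda>h. - of_nat j * a k * h / zc x k ^ Suc j)"
        by (intro ext) simp
      ultimately have "((\<lambda>w. a k / w ^ j) has_derivative (\<lambda>h. - of_nat j * a k * h / zc x k ^ Suc j)) (at (zc x k))"
        by (simp only: has_field_derivative_def)
      from has_derivative_compose[OF has_derivative_zc[OF has_derivative_ident] this]
      show "((\<lambda>x. a k / zc x k ^ j) has_derivative (\<lambda>v. - of_nat j * a k * zc v k / zc x k ^ Suc j)) (at x)" .
    qed
    moreover have "(\<lambda>x. ?f (\<lambda>k. - of_nat j * a k * zc v k) (Suc j) x) \<in> ?F" for v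
      by (rule range_eqI[where x = "(\<lambda>k. - of_nat j * a k * zc v k, Suc j)"]) simp
    ultimately show "\<exists>D. (\<forall>x\<in>W. (g has_derivative D x) (at x)) \<and> (\<forall>v. (\<lambda>x. D x v) \<in> ?F)"
      by (intro exI[of _ "\<lambda>x v. ?f (\<lambda>k. - of_nat j * a k * zc v k) (Suc j) x"]) blast
  qed
  \<comment> \<open>The pair \<open>(a, j)\<close> is not determined by the function it defines, so
    a derivative is chosen for each member.\<close>
  from bchoice[OF this] obtain D where D: "\<forall>g\<in>?F. (\<forall>x\<in>W. (g has_derivative D g x) (at x)) \<and> (\<forall>v. (\<lambda>x. D g x v) \<in> ?F)" ..
  have "?f a j \<in> ?F" by (rule range_eqI[where x = "(a, j)"]) simp
  with \<open>open W\<close> show ?thesis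
  proof (rule smooth_open_family[where D = D])
    show "(g has_derivative D g x) (at x)" if "g \<in> ?F" "x \<in> W" for g x
      using bspec[OF conjunct1[OF bspec[OF D that(1)]] that(2)] .
    show "(\<lambda>x. D g x v) \<in> ?F" if "g \<in> ?F" for g v
      using spec[OF conjunct2[OF bspec[OF D that(1)]]] .
  qed
qed

text \<open>Positive real parts keep the quotient off the branch cut, and the derivative
  \<open>zc v k / zc x k\<close> falls under \<open>smooth_open_ratio\<close> with exponent
  1.\<close>

lemma smooth_open_Ln:
  assumes "open W" "\<And>x k. x \<in> W \<Longrightarrow> k \<in> {1..m} \<Longrightarrow> 0 < Re (zc x k / a k)"
  shows "smooth_open W (\<lambda>x. vc (\<lambda>k. Ln (zc x k / a k)))"
    (is "smooth_open W ?g")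
proof -
  have nz: "zc x k \<noteq> 0" "a k \<noteq> 0" if "x \<in> W" "k \<in> {1..m}" for x k
    using assms(2)[OF that] by auto
  have D: "(?g has_derivative (\<lambda>v. vc (\<lambda>k. zc v k / zc x k ^ 1))) (at x)" if x: "x \<in> W" for x
  proof (rule has_derivative_vc)
    fix k assume k: "k \<in> {1..m}"
    have "zc x k / a k \<notin> \<real>\<^sub>\<le>\<^sub>0"
      using assms(2)[OF x k] by (auto simp: complex_nonpos_Reals_iff)
    from DERIV_chain2[OF has_field_derivative_Ln[OF this] DERIV_cdivide[OF DERIV_ident]]
    have "((\<lambda>w. Ln (w / a k)) has_field_derivative 1 / zc x k) (at (zc x k))"
      using nz[OF x k] by (simp add: field_simps)
    from has_field_derivative_imp_has_derivative[OF this]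
    have "((\<lambda>w. Ln (w / a k)) has_derivative (\<lambda>h. 1 / zc x k * h)) (at (zc x k))" .
    from has_derivative_compose[OF has_derivative_zc[OF has_derivative_ident] this]
    show "((\<lambda>x. Ln (zc x k / a k)) has_derivative (\<lambda>v. zc v k / zc x k ^ 1)) (at x)"
      by simp
  qed
  show ?thesis
    by (rule smooth_openI[OF assms(1) D smooth_open_ratio[OF assms(1) nz(1)]])
qed

section \<open>The hypersurface\<close>

definition unit_product :: "(real ^ 'd) set" where
  "unit_product = {x. (\<Prod>k=1..m. (cmod (zc x k))\<^sup>2) = 1}"

text \<open>\<open>logd p\<close> is the differential at \<open>p\<close> of \<open>\<Sum> ln \<bar>z\<^sub>k\<bar>\<close>, and \<open>kform p\<close> is minus its Hessian.\<close>

definition logd :: "real ^ 'd \<Rightarrow> real ^ 'd \<Rightarrow> real" where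
  "logd p v = (\<Sum>k=1..m. Re (zc v k / zc p k))"

definition kform :: "real ^ 'd \<Rightarrow> real ^ 'd \<Rightarrow> real ^ 'd \<Rightarrow> real" where
  "kform p v w = (\<Sum>k=1..m. Re (zc v k * zc w k / (zc p k)\<^sup>2))"

lemma unit_product_nonzero: "p \<in> unit_product \<Longrightarrow> k \<in> {1..m} \<Longrightarrow> zc p k \<noteq> 0"
  unfolding unit_product_def by (metis (mono_tags, lifting) finite_atLeastAtMost mem_Collect_eq norm_zero
      power_zero_numeral prod_zero zero_neq_one)

lemma Re_scaleR_divide: "Re (r *\<^sub>R a / b) = r * Re (a / b)"
proof -
  have "r *\<^sub>R a / b = r *\<^sub>R (a / b)" by (simp add: divide_inverse)
  then show ?thesis by simp
qed

lemma linear_logd: "linear (logd p)"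
  by (rule linearI)
    (simp_all add: logd_def add_divide_distrib sum.distrib sum_distrib_left Re_scaleR_divide)

lemma logd_vc: "logd p (vc a) = (\<Sum>k=1..m. Re (a k / zc p k))"
  unfolding logd_def by (intro sum.cong) auto

text \<open>Each quotient is the real number \<open>c\<close>. Nonzero multiples of \<open>p\<close>
  therefore lie outside the kernel of \<open>logd p\<close>, which makes the radial field
  transversal.\<close>

lemma logd_self: "p \<in> unit_product \<Longrightarrow> logd p (c *\<^sub>R p) = c * m"
  unfolding logd_def by (simp add: unit_product_nonzero Re_scaleR_divide)

text \<open>The factors \<open>exp (a k)\<close> multiply the product by
  \<open>exp (2 * \<Sum> Re a_k) = 1\<close>.\<close>

lemma unit_product_exp:
  assumes p: "p \<in> unit_product" and a: "(\<Sum>k=1..m. Re (a k)) = 0"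
  shows "vc (\<lambda>k. zc p k * exp (a k)) \<in> unit_product"
proof -
  have "(\<Prod>k=1..m. (cmod (zc p k * exp (a k)))\<^sup>2) = (\<Prod>k=1..m. (cmod (zc p k))\<^sup>2 * (exp (Re (a k)))\<^sup>2)"
    by (simp add: norm_mult power_mult_distrib)
  also have "\<dots> = (\<Prod>k=1..m. (cmod (zc p k))\<^sup>2) * (exp (\<Sum>k=1..m. Re (a k)))\<^sup>2"
    by (simp add: prod.distrib exp_sum prod_power_distrib)
  also have "\<dots> = 1" using p a by (simp add: unit_product_def)
  finally show ?thesis by (simp add: unit_product_def cong: prod.cong_simp)
qed

text \<open>Puts the equation into the additive form that is differentiated for the tangent space
  and straightened by the charts.\<close>

lemma unit_product_sum_ln:
  assumes "\<And>k. k \<in> {1..m} \<Longrightarrow> zc x k \<noteq> 0"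
  shows "x \<in> unit_product \<longleftrightarrow> (\<Sum>k=1..m. ln (cmod (zc x k))) = 0"
proof -
  have "(\<Prod>k=1..m. (cmod (zc x k))\<^sup>2) = exp (2 * (\<Sum>k=1..m. ln (cmod (zc x k))))"
    using assms by (simp add: sum_distrib_left exp_sum exp_double)
  then show ?thesis by (simp add: unit_product_def)
qed

text \<open>The function \<open>\<Sum> ln |z_k|\<close> vanishes on the hypersurface, so
  \<open>logd p\<close> and 0 are both derivatives of it within the hypersurface and agree on
  tangent vectors. Conversely an explicit curve realises each vector of the kernel.\<close>

lemma tangent_space_unit_product:
  assumes p: "p \<in> unit_product"
  shows "tangent_space unit_product p = {v. logd p v = 0}"
proof (intro equalityI subsetI)
  fix v assume "v \<in> tangent_space unit_product p"
  have "((\<lambda>x. \<Sum>k=1..m. ln (cmod (zc x k))) has_derivative logd p) (at p)"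
    unfolding logd_def
  proof (rule has_derivative_sum)
    fix k assume k: "k \<in> {1..m}"
    have "((\<lambda>x. cmod (zc x k)) has_derivative (\<lambda>v. inner (zc v k) (sgn (zc p k)))) (at p)"
      by (rule has_derivative_compose[OF has_derivative_zc[OF has_derivative_ident]
            has_derivative_norm[OF unit_product_nonzero[OF p k]]])
    then have "((\<lambda>x. ln (cmod (zc x k))) has_derivative
        (\<lambda>v. inner (zc v k) (sgn (zc p k)) * inverse (cmod (zc p k)))) (at p)"
      using unit_product_nonzero[OF p k] by (auto intro!: derivative_eq_intros)
    moreover have "inner (zc v k) (sgn (zc p k)) * inverse (cmod (zc p k)) = Re (zc v k / zc p k)" for v
    proof -
      have "(Re (zc p k))\<^sup>2 + (Im (zc p k))\<^sup>2 = cmod (zc p k) * cmod (zc p k)"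
        by (simp add: cmod_power2 flip: power2_eq_square)
      then show ?thesis
        by (simp add: sgn_div_norm inner_complex_def Re_divide divide_inverse algebra_simps)
    qed
    ultimately show "((\<lambda>x. ln (cmod (zc x k))) has_derivative (\<lambda>v. Re (zc v k / zc p k))) (at p)"
      by simp
  qed
  then have D: "((\<lambda>x. \<Sum>k=1..m. ln (cmod (zc x k))) has_derivative logd p) (at p within unit_product)"
    by (rule has_derivative_at_withinI)
  have "(\<Sum>k=1..m. ln (cmod (zc q k))) = 0" if "q \<in> unit_product" for q
    using unit_product_sum_ln[of q] unit_product_nonzero[OF that] that by blast
  from has_derivative_cong_within[OF p this]
  have "((\<lambda>x. \<Sum>k=1..m. ln (cmod (zc x k))) has_derivative (\<lambda>v. 0)) (at p within unit_product)"
    by simp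
  from pushforward_eq[OF D] pushforward_eq[OF this] \<open>v \<in> tangent_space unit_product p\<close>
  show "v \<in> {v. logd p v = 0}" by simp
next
  fix v assume v: "v \<in> {v. logd p v = 0}"
  \<comment> \<open>The curve has velocity \<open>zc v k\<close> in coordinate \<open>k\<close> at
    time 0; by \<open>logd p v = 0\<close> the real parts of the exponents sum to zero, so it stays
    on the hypersurface.\<close>
  let ?\<gamma> = "\<lambda>t :: real. vc (\<lambda>k. zc p k * exp (t *\<^sub>R (zc v k / zc p k)))"
  have "smooth_open UNIV ?\<gamma>"
    by (rule smooth_open_exp) (rule bounded_linear_scaleR_left)
  moreover have "?\<gamma> t \<in> unit_product" for t
  proof (rule unit_product_exp[OF p])
    have "(\<Sum>k=1..m. Re (t *\<^sub>R (zc v k / zc p k))) = t * logd p v"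
      by (simp add: logd_def sum_distrib_left)
    then show "(\<Sum>k=1..m. Re (t *\<^sub>R (zc v k / zc p k))) = 0" using v by simp
  qed
  moreover have "?\<gamma> 0 = p" by simp
  moreover have "(?\<gamma> has_vector_derivative v) (at 0)"
  proof -
    have "(?\<gamma> has_derivative (\<lambda>h. vc (\<lambda>k. h *\<^sub>R zc v k))) (at 0)"
    proof (rule has_derivative_vc)
      fix k assume k: "k \<in> {1..m}"
      have "((\<lambda>t. zc p k * exp (t *\<^sub>R (zc v k / zc p k))) has_vector_derivative
          zc p k * (zc v k / zc p k * exp (0 *\<^sub>R (zc v k / zc p k)))) (at 0)"
        by (intro has_vector_derivative_mult_right exp_scaleR_has_vector_derivative_left)
      then show "((\<lambda>t. zc p k * exp (t *\<^sub>R (zc v k / zc p k))) has_derivative (\<lambda>h. h *\<^sub>R zc v k)) (at 0)"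
        using unit_product_nonzero[OF p k] by (simp add: has_vector_derivative_def)
    qed
    moreover have "vc (\<lambda>k. h *\<^sub>R zc v k) = h *\<^sub>R v" for h
      by (rule vec_eqI) simp
    ultimately show ?thesis by (simp add: has_vector_derivative_def)
  qed
  ultimately show "v \<in> tangent_space unit_product p"
    by (rule tangent_spaceI)
qed

lemma dim_hyperplane_zc: "dim {w. (\<Sum>k=1..m. Re (zc w k)) = 0} = 2 * m - 1"
proof -
  have "(\<Sum>k=1..m. Re (zc w k)) = inner (vc (\<lambda>k. 1)) w" for w
    unfolding inner_vec_def by (subst sum_e) (simp add: vc_nth zc_def)
  moreover have "vc (\<lambda>k. 1) \<noteq> 0"
    using m_pos by (metis One_nat_def Suc_leI atLeastAtMost_iff le_refl zc_linear(3) zc_vc zero_neq_one)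
  ultimately show ?thesis
    by (simp add: dim_hyperplane card_d)
qed

text \<open>The chart around \<open>p\<close> is the coordinatewise logarithm of
  \<open>z_k / p_k\<close>, which straightens the hypersurface to the hyperplane
  \<open>\<Sum> Re w_k = 0\<close>.\<close>

lemma submanifold_unit_product: "submanifold (CARD('d) - 1) unit_product"
  unfolding submanifold_def
proof
  fix p assume p: "p \<in> unit_product"
  note nz = unit_product_nonzero[OF p]
  \<comment> \<open>Right half-planes and strips of half-width \<open>pi / 2\<close> correspond
    under \<open>Ln\<close> and \<open>exp\<close> and stay within the principal branch.\<close>
  let ?W = "{x. \<forall>k\<in>{1..m}. 0 < Re (zc x k / zc p k)}"
  let ?V = "{w. \<forall>k\<in>{1..m}. \<bar>Im (zc w k)\<bar> < pi / 2}"
  let ?E = "{w. (\<Sum>k=1..m. Re (zc w k)) = 0}"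
  let ?\<phi> = "\<lambda>x. vc (\<lambda>k. Ln (zc x k / zc p k))"
  let ?\<psi> = "\<lambda>w. vc (\<lambda>k. zc p k * exp (zc w k))"
  have W_eq: "?W = (\<Inter>k\<in>{1..m}. {x. 0 < Re (zc x k / zc p k)})" by auto
  have V_eq: "?V = (\<Inter>k\<in>{1..m}. {w. \<bar>Im (zc w k)\<bar> < pi / 2})" by auto
  have oW: "open ?W"
    unfolding W_eq unfolding divide_inverse
    by (intro open_INT ballI open_Collect_less continuous_intros finite_atLeastAtMost)
  have oV: "open ?V"
    unfolding V_eq by (intro open_INT ballI open_Collect_less continuous_intros finite_atLeastAtMost)
  have s\<phi>: "smooth_open ?W ?\<phi>" by (rule smooth_open_Ln[OF oW]) simp
  have s\<psi>: "smooth_open ?V ?\<psi>"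
    by (rule smooth_open_subset[OF smooth_open_exp[OF bounded_linear_zc] oV]) simp
  have \<psi>\<phi>: "?\<psi> (?\<phi> x) = x" if "x \<in> ?W" for x
  proof (rule vec_eqI)
    fix k assume k: "k \<in> {1..m}"
    then have "zc x k / zc p k \<noteq> 0" using that by fastforce
    then show "zc (?\<psi> (?\<phi> x)) k = zc x k" using k nz[OF k] by simp
  qed
  have \<phi>\<psi>: "?\<phi> (?\<psi> w) = w" if "w \<in> ?V" for w
  proof (rule vec_eqI)
    fix k assume k: "k \<in> {1..m}"
    then have "\<bar>Im (zc w k)\<bar> < pi / 2" using that by blast
    then have "- pi < Im (zc w k)" "Im (zc w k) \<le> pi" using pi_gt_zero by linarith+
    then show "zc (?\<phi> (?\<psi> w)) k = zc w k" using k nz[OF k] by simp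
  qed
  have \<phi>V: "?\<phi> x \<in> ?V" if "x \<in> ?W" for x
  proof -
    have "\<forall>k\<in>{1..m}. \<bar>Im (Ln (zc x k / zc p k))\<bar> < pi / 2"
      using that Re_Ln_pos_lt_imp by blast
    then show ?thesis by simp
  qed
  have \<psi>W: "?\<psi> w \<in> ?W" if "w \<in> ?V" for w
  proof -
    have "0 < Re (exp (zc w k))" if k: "k \<in> {1..m}" for k
    proof -
      have "\<bar>Im (zc w k)\<bar> < pi / 2" using k \<open>w \<in> ?V\<close> by blast
      then have "0 < cos (Im (zc w k))" by (intro cos_gt_zero_pi) linarith+
      then show ?thesis by (simp add: Re_exp)
    qed
    then show ?thesis using nz by simp
  qed
  have \<phi>E: "?\<phi> x \<in> ?E" if x: "x \<in> ?W" "x \<in> unit_product" for x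
  proof -
    have "(\<Sum>k=1..m. Re (zc (?\<phi> x) k)) = (\<Sum>k=1..m. ln (cmod (zc x k)) - ln (cmod (zc p k)))"
    proof (rule sum.cong[OF refl])
      fix k assume k: "k \<in> {1..m}"
      with nz unit_product_nonzero[OF x(2)] show "Re (zc (?\<phi> x) k) = ln (cmod (zc x k)) - ln (cmod (zc p k))"
        by (simp add: norm_divide ln_div)
    qed
    also have "\<dots> = 0"
      using unit_product_sum_ln[of x] unit_product_sum_ln[of p] x(2) p nz unit_product_nonzero[OF x(2)]
      by (simp add: sum_subtractf)
    finally show ?thesis by simp
  qed
  have \<psi>T: "?\<psi> w \<in> unit_product" if "w \<in> ?E" for w
    using unit_product_exp[OF p, of "zc w"] that by simp
  have "subspace ?E"
    by (rule subspaceI) (simp_all add: sum.distrib flip: sum_distrib_left)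
  moreover have "dim ?E = CARD('d) - 1"
    using dim_hyperplane_zc by (simp add: card_d)
  moreover have "p \<in> ?W" using nz by simp
  ultimately show "\<exists>W V \<phi> \<psi> E. p \<in> W \<and> smooth_open W \<phi> \<and> smooth_open V (\<psi> :: real ^ 'd \<Rightarrow> real ^ 'd) \<and>
      homeomorphism W V \<phi> \<psi> \<and> subspace E \<and> dim E = CARD('d) - 1 \<and> \<phi> ` (W \<inter> unit_product) = V \<inter> E"
    using \<phi>V \<psi>\<phi> \<phi>E \<psi>W \<phi>\<psi> \<psi>T
    by (intro slice_chartI[OF _ s\<phi> s\<psi>])
qed

section \<open>The affine normal\<close>

text \<open>Tangency of \<open>Y\<close> says that \<open>logd q (Y q)\<close> vanishes along the
  hypersurface; by the quotient rule its derivative along \<open>X\<close> is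
  \<open>logd p (D_X Y) - kform p (X p) (Y p)\<close>.\<close>

lemma logd_Dflat:
  assumes Y: "diff_field unit_product Y" and p: "p \<in> unit_product" and X: "X p \<in> tangent_space unit_product p"
  shows "logd p (Dflat unit_product X Y p) = kform p (X p) (Y p)"
proof -
  obtain D where D: "(Y has_derivative D) (at p within unit_product)"
    using Y p unfolding diff_field_def differentiable_def by blast
  have "((\<lambda>q. logd q (Y q)) has_derivative (\<lambda>v. logd p (D v) - kform p v (Y p))) (at p within unit_product)"
    unfolding logd_def kform_def sum_subtractf[symmetric]
  proof (rule has_derivative_sum)
    fix k assume k: "k \<in> {1..m}"
    have "((\<lambda>q. zc (Y q) k / zc q k) has_derivative
        (\<lambda>v. (zc (D v) k * zc p k - zc (Y p) k * zc v k) / (zc p k * zc p k))) (at p within unit_product)"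
      by (rule has_derivative_divide'[OF has_derivative_zc[OF D] has_derivative_zc[OF has_derivative_ident]
            unit_product_nonzero[OF p k]])
    moreover have "(zc (D v) k * zc p k - zc (Y p) k * zc v k) / (zc p k * zc p k) =
        zc (D v) k / zc p k - zc v k * zc (Y p) k / (zc p k)\<^sup>2" for v
      using unit_product_nonzero[OF p k] by (simp add: field_simps power2_eq_square)
    ultimately have "((\<lambda>q. zc (Y q) k / zc q k) has_derivative
        (\<lambda>v. zc (D v) k / zc p k - zc v k * zc (Y p) k / (zc p k)\<^sup>2)) (at p within unit_product)"
      by (simp only:)
    from has_derivative_Re[OF this]
    show "((\<lambda>q. Re (zc (Y q) k / zc q k)) has_derivative
        (\<lambda>v. Re (zc (D v) k / zc p k) - Re (zc v k * zc (Y p) k / (zc p k)\<^sup>2))) (at p within unit_product)"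
      by (simp only: minus_complex.simps)
  qed
  note 1 = pushforward_eq[OF this X]
  have "logd q (Y q) = 0" if "q \<in> unit_product" for q
    using Y that tangent_space_unit_product[OF that] by (auto simp: diff_field_def)
  from has_derivative_cong_within[OF p this]
  have "((\<lambda>q. logd q (Y q)) has_derivative (\<lambda>v. 0)) (at p within unit_product)"
    by simp
  from pushforward_eq[OF this X] 1 show ?thesis
    by (simp add: Dflat_eq[where X = X, OF D X])
qed

text \<open>The positive solution \<open>s\<close> of \<open>s^(2m+1) m^(2m) = 1\<close>, the
  condition under which \<open>\<Theta>^2 = |det h|\<close>.\<close>

definition blaschke_scale :: real where
  "blaschke_scale = root (2 * m + 1) (1 / real m ^ (2 * m))"

lemma blaschke_scale_pos: "0 < blaschke_scale"
  using m_pos by (simp add: blaschke_scale_def)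

lemma blaschke_scale_power: "blaschke_scale ^ (2 * m + 1) * real m ^ (2 * m) = 1"
proof -
  have "blaschke_scale ^ (2 * m + 1) = 1 / real m ^ (2 * m)"
    unfolding blaschke_scale_def by (rule real_root_pow_pos2) auto
  then show ?thesis using m_pos by simp
qed

definition blaschke :: "real ^ 'd \<Rightarrow> real ^ 'd" where
  "blaschke x = blaschke_scale *\<^sub>R x"

lemma linear_blaschke: "linear blaschke"
  unfolding blaschke_def by (rule linear_scaleR)

lemma logd_blaschke: "p \<in> unit_product \<Longrightarrow> logd p (blaschke p) = blaschke_scale * m"
  by (simp only: blaschke_def logd_self)

lemma logd_blaschke_nonzero: "p \<in> unit_product \<Longrightarrow> logd p (blaschke p) \<noteq> 0"
  using blaschke_scale_pos m_pos by (simp add: logd_blaschke)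

text \<open>The transversal coefficient is the quotient of the values of \<open>logd p\<close> at
  \<open>D_X Y\<close> and at \<open>C\<close>. Asking \<open>diff_field\<close> rather than
  smoothness of \<open>Y\<close> admits \<open>\<nabla>_X X_i\<close> as an argument.\<close>

lemma second_fundamental_form_unit_product:
  assumes Y: "diff_field unit_product Y" and p: "p \<in> unit_product" and X: "X p \<in> tangent_space unit_product p"
  shows "second_fundamental_form unit_product (\<lambda>x. x) blaschke X Y p =
    kform p (X p) (Y p) / (blaschke_scale * m)"
proof -
  have "second_fundamental_form unit_product (\<lambda>x. x) blaschke X Y p =
     (THE a. \<exists>Z\<in>tangent_space unit_product p. Dflat unit_product X Y p = Z + a *\<^sub>R blaschke p)"
    unfolding second_fundamental_form_def Dflat_Dflat_id[OF Y p]
    by (simp add: pushforward_id cong: bex_cong)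
  also have "\<dots> = logd p (Dflat unit_product X Y p) / logd p (blaschke p)"
    by (rule the_transversal_component[OF linear_logd logd_blaschke_nonzero[OF p] tangent_space_unit_product[OF p]])
  finally show ?thesis
    by (simp only: logd_Dflat[where X = X, OF assms] logd_blaschke[OF p])
qed

lemma induced_connection_unit_product:
  assumes Y: "diff_field unit_product Y" and p: "p \<in> unit_product" and X: "X p \<in> tangent_space unit_product p"
  shows "induced_connection unit_product (\<lambda>x. x) blaschke X Y p =
    Dflat unit_product X Y p - (kform p (X p) (Y p) / (blaschke_scale * m)) *\<^sub>R blaschke p"
proof -
  have "induced_connection unit_product (\<lambda>x. x) blaschke X Y p =
     (THE Z. Z \<in> tangent_space unit_product p \<and> (\<exists>a. Dflat unit_product X Y p = Z + a *\<^sub>R blaschke p))"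
    unfolding induced_connection_def Dflat_Dflat_id[OF Y p]
    by (simp add: pushforward_id cong: conj_cong)
  also have "\<dots> = Dflat unit_product X Y p - (logd p (Dflat unit_product X Y p) / logd p (blaschke p)) *\<^sub>R blaschke p"
    by (rule the_tangential_component[OF linear_logd logd_blaschke_nonzero[OF p] tangent_space_unit_product[OF p]])
  finally show ?thesis
    by (simp only: logd_Dflat[where X = X, OF assms] logd_blaschke[OF p])
qed

text \<open>Subtracting the multiple of \<open>C\<close> with the same value under
  \<open>logd p\<close> leaves a tangential vector. This makes the volume form computable on tuples
  containing \<open>\<nabla>_X X_i\<close>.\<close>

lemma diff_field_induced_connection:
  assumes X: "vector_field unit_product X" and Y: "vector_field unit_product Y"
  shows "diff_field unit_product (induced_connection unit_product (\<lambda>x. x) blaschke X Y)"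
  unfolding diff_field_def
proof (intro ballI conjI)
  note X' = vector_field_imp_diff_field[OF X] and Y' = vector_field_imp_diff_field[OF Y]
  have eq: "induced_connection unit_product (\<lambda>x. x) blaschke X Y q =
      Dflat unit_product X Y q - (kform q (X q) (Y q) / (blaschke_scale * m)) *\<^sub>R blaschke q" if "q \<in> unit_product" for q
    using induced_connection_unit_product[where X = X, OF Y' that] X' that by (simp add: diff_field_def)
  fix p assume p: "p \<in> unit_product"
  have "logd p (Dflat unit_product X Y p) = kform p (X p) (Y p)"
    using logd_Dflat[where X = X, OF Y' p] X' p by (simp add: diff_field_def)
  then show "induced_connection unit_product (\<lambda>x. x) blaschke X Y p \<in> tangent_space unit_product p"
    using logd_blaschke[OF p] logd_blaschke_nonzero[OF p] eq[OF p] tangent_space_unit_product[OF p]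
    by (simp add: linear_diff[OF linear_logd] linear_scale[OF linear_logd])
  obtain D1 D2 D3 where D: "(X has_derivative D1) (at p within unit_product)" "(Y has_derivative D2) (at p within unit_product)"
    "(Dflat unit_product X Y has_derivative D3) (at p within unit_product)"
    using X' Y' Dflat_differentiable[OF X _ p] Y p
    unfolding diff_field_def vector_field_def differentiable_def by blast
  have "(\<lambda>q. Re (zc (X q) k * zc (Y q) k / (zc q k)\<^sup>2)) differentiable (at p within unit_product)"
    if k: "k \<in> {1..m}" for k
    by (rule differentiableI, rule has_derivative_Re, rule has_derivative_divide'[OF
          has_derivative_mult[OF has_derivative_zc[OF D(1)] has_derivative_zc[OF D(2)]]
          has_derivative_power[OF has_derivative_zc[OF has_derivative_ident]]])
      (use unit_product_nonzero[OF p k] in simp)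
  then have "(\<lambda>q. kform q (X q) (Y q)) differentiable (at p within unit_product)"
    unfolding kform_def by (intro differentiable_sum ballI) auto
  from differentiable_scaleR[OF differentiable_mult[OF this differentiable_const]
      linear_imp_differentiable[OF linear_blaschke]]
  have "(\<lambda>q. (kform q (X q) (Y q) * inverse (blaschke_scale * m)) *\<^sub>R blaschke q) differentiable (at p within unit_product)" .
  then have "(\<lambda>q. Dflat unit_product X Y q - (kform q (X q) (Y q) / (blaschke_scale * m)) *\<^sub>R blaschke q)
      differentiable (at p within unit_product)"
    unfolding divide_inverse using D(3) by (intro differentiable_diff) (auto intro: differentiableI)
  then show "induced_connection unit_product (\<lambda>x. x) blaschke X Y differentiable (at p within unit_product)"
    using has_derivative_cong_within[OF p eq] unfolding differentiable_def by simp
qed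

lemma nondegenerate_unit_product: "nondegenerate unit_product (\<lambda>x. x) blaschke"
  unfolding nondegenerate_def
proof (intro ballI allI impI)
  fix p X assume p: "p \<in> unit_product" and X: "vector_field unit_product X"
    and 0: "\<forall>Y. vector_field unit_product Y \<longrightarrow> second_fundamental_form unit_product (\<lambda>x. x) blaschke X Y p = 0"
  let ?u = "\<lambda>k. zc (X p) k / zc p k"
  \<comment> \<open>Test field: conjugating the ratios \<open>?u k\<close> keeps their real parts,
    so the field is tangential everywhere, and it turns \<open>kform p (X p) (?Y p)\<close> into a
    sum of squared moduli. Being linear in \<open>q\<close>, it is smooth.\<close>
  let ?Y = "\<lambda>q. vc (\<lambda>k. cnj (?u k) * zc q k)"
  have Xp: "X p \<in> tangent_space unit_product p" using X p by (simp add: vector_field_def)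
  have "?Y q \<in> tangent_space unit_product q" if q: "q \<in> unit_product" for q
  proof -
    have "logd q (?Y q) = (\<Sum>k=1..m. Re (?u k))"
      unfolding logd_vc using unit_product_nonzero[OF q] by (intro sum.cong) (auto simp del: complex_cnj_divide)
    also have "\<dots> = logd p (X p)" by (simp add: logd_def)
    finally show ?thesis using Xp by (simp add: tangent_space_unit_product p q)
  qed
  moreover have "linear ?Y"
    by (rule linear_vc_comp) (auto intro!: linearI simp: algebra_simps simp del: complex_cnj_divide)
  ultimately have Y: "vector_field unit_product ?Y"
    by (simp add: vector_field_def smooth_map_linear)
  have "kform p (X p) (?Y p) = 0"
    using 0 Y second_fundamental_form_unit_product[where X = X, OF vector_field_imp_diff_field[OF Y] p Xp]
      logd_blaschke_nonzero[OF p] by (simp add: logd_blaschke[OF p] del: complex_cnj_divide)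
  moreover have "kform p (X p) (?Y p) = (\<Sum>k=1..m. (cmod (?u k))\<^sup>2)"
    unfolding kform_def
  proof (rule sum.cong[OF refl])
    fix k assume k: "k \<in> {1..m}"
    have "zc (X p) k * zc (?Y p) k / (zc p k)\<^sup>2 = ?u k * cnj (?u k)"
      using k unit_product_nonzero[OF p k] by (simp add: field_simps power2_eq_square)
    then show "Re (zc (X p) k * zc (?Y p) k / (zc p k)\<^sup>2) = (cmod (?u k))\<^sup>2"
      by (simp only: complex_norm_square[symmetric] Re_complex_of_real)
  qed
  ultimately have "\<forall>k\<in>{1..m}. ?u k = 0"
    by (simp add: sum_nonneg_eq_0_iff)
  then have "zc (X p) k = zc 0 k" if "k \<in> {1..m}" for k
    using that unit_product_nonzero[OF p that] by fastforce
  then show "X p = 0" by (rule vec_eqI)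
qed

lemma transversal_field_unit_product: "transversal_field unit_product (\<lambda>x. x) blaschke"
  unfolding transversal_field_def
  using smooth_map_linear[OF linear_blaschke] logd_blaschke_nonzero
  by (auto simp: pushforward_id tangent_space_unit_product)

lemma hypersurface_immersion_unit_product: "hypersurface_immersion unit_product (\<lambda>x. x)"
  unfolding hypersurface_immersion_def
  using submanifold_unit_product smooth_map_linear[OF linear_id, unfolded id_def]
  by (auto simp: inj_on_def pushforward_id)

lemma shape_operator_unit_product:
  assumes X: "vector_field unit_product X" and p: "p \<in> unit_product"
  shows "shape_operator unit_product (\<lambda>x. x) blaschke X p = (- blaschke_scale) *\<^sub>R X p"
proof -
  have Xp: "X p \<in> tangent_space unit_product p" using X p by (simp add: vector_field_def)
  have D: "Dflat unit_product X blaschke p = blaschke (X p)"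
    by (rule Dflat_eq[where X = X, OF linear_imp_has_derivative[OF linear_blaschke] Xp])
  have "shape_operator unit_product (\<lambda>x. x) blaschke X p =
     (THE Z. Z \<in> tangent_space unit_product p \<and> (\<exists>a. blaschke (X p) = - Z + a *\<^sub>R blaschke p))"
    unfolding shape_operator_def D by (simp add: pushforward_id cong: conj_cong)
  also have "\<dots> = (logd p (blaschke (X p)) / logd p (blaschke p)) *\<^sub>R blaschke p - blaschke (X p)"
    by (rule the_negative_tangential_component[OF linear_logd logd_blaschke_nonzero[OF p] tangent_space_unit_product[OF p]])
  also have "logd p (blaschke (X p)) = 0"
    using Xp p by (simp add: tangent_space_unit_product blaschke_def linear_scale[OF linear_logd] del: scaleR_conv_of_real)
  finally show ?thesis by (simp add: blaschke_def[of "X p"])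
qed

lemma complex_structure_tangent:
  assumes p: "p \<in> unit_product"
  shows "complex_structure e (blaschke p) \<in> tangent_space unit_product p"
proof -
  have "logd p (complex_structure e (blaschke p)) = 0"
    unfolding complex_structure_eq logd_vc
    using unit_product_nonzero[OF p] by (intro sum.neutral) (auto simp: blaschke_def Re_scaleR_divide)
  then show ?thesis by (simp add: tangent_space_unit_product p)
qed

section \<open>The volume forms\<close>

text \<open>The matrix of \<open>kform p\<close> in real coordinates: for
  \<open>z = a + \<i> b\<close> and \<open>z' = c + \<i> d\<close>,
  \<open>Re (w z z') = Re w (a c - b d) - Im w (a d + b c)\<close>. Matrix indices start at 0 and
  coordinates at 1, hence \<open>Suc\<close>.\<close>

definition kmat :: "real ^ 'd \<Rightarrow> real mat" where
  "kmat p = (let w = \<lambda>i. 1 / (zc p (Suc i))\<^sup>2 in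
     four_block_mat (mat_diag m (\<lambda>i. Re (w i))) (mat_diag m (\<lambda>i. - Im (w i)))
       (mat_diag m (\<lambda>i. - Im (w i))) (mat_diag m (\<lambda>i. - Re (w i))))"

lemma kmat_carrier: "kmat p \<in> carrier_mat (2 * m) (2 * m)"
  unfolding kmat_def Let_def mult_2 by (rule four_block_carrier_mat) auto

lemma sum_double: "(\<Sum>a<2 * m. f a) = (\<Sum>k<m. f k + f (k + m))" for f :: "nat \<Rightarrow> 'b::comm_monoid_add"
proof -
  have "{..<2 * m} = {..<m} \<union> {0 + m..<m + m}" by auto
  moreover have "sum f ({..<m} \<union> {0 + m..<m + m}) = (\<Sum>a<m. f a) + (\<Sum>a=0+m..<m+m. f a)"
    by (rule sum.union_disjoint) auto
  ultimately have "(\<Sum>a<2 * m. f a) = (\<Sum>a<m. f a) + (\<Sum>a=0+m..<m+m. f a)"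
    by (simp only:)
  then show ?thesis
    by (simp only: sum.shift_bounds_nat_ivl sum.distrib atLeast0LessThan)
qed

lemma kform_kmat:
  "kform p v w = (\<Sum>a<2 * m. \<Sum>b<2 * m. v $ e (Suc a) * kmat p $$ (a, b) * w $ e (Suc b))"
proof -
  let ?w = "\<lambda>k. 1 / (zc p (Suc k))\<^sup>2"
  \<comment> \<open>Row \<open>a\<close> can be nonzero only in the two columns congruent to
    \<open>a\<close> modulo \<open>m\<close>; \<open>sum_double\<close> puts both into one
    summand.\<close>
  have row: "(\<Sum>b<2 * m. v $ e (Suc a) * kmat p $$ (a, b) * w $ e (Suc b)) =
      (if a < m then v $ e (Suc a) * (Re (?w a) * w $ e (Suc a) - Im (?w a) * w $ e (Suc (a + m)))
       else v $ e (Suc a) * (- Im (?w (a - m)) * w $ e (Suc (a - m)) - Re (?w (a - m)) * w $ e (Suc a)))"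
    if "a < 2 * m" for a
  proof -
    have "(\<Sum>b<2 * m. v $ e (Suc a) * kmat p $$ (a, b) * w $ e (Suc b)) =
      (\<Sum>k<m. if k = (if a < m then a else a - m) then
         (if a < m then v $ e (Suc a) * (Re (?w a) * w $ e (Suc a) - Im (?w a) * w $ e (Suc (a + m)))
       else v $ e (Suc a) * (- Im (?w (a - m)) * w $ e (Suc (a - m)) - Re (?w (a - m)) * w $ e (Suc a))) else 0)"
      unfolding sum_double
      by (rule sum.cong[OF refl]) (use that in \<open>auto simp: kmat_def Let_def mat_diag_def algebra_simps\<close>)
    also have "\<dots> = (if a < m then v $ e (Suc a) * (Re (?w a) * w $ e (Suc a) - Im (?w a) * w $ e (Suc (a + m)))
       else v $ e (Suc a) * (- Im (?w (a - m)) * w $ e (Suc (a - m)) - Re (?w (a - m)) * w $ e (Suc a)))"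
      using that by (subst sum.delta) auto
    finally show ?thesis .
  qed
  have "(\<Sum>a<2 * m. \<Sum>b<2 * m. v $ e (Suc a) * kmat p $$ (a, b) * w $ e (Suc b)) =
      (\<Sum>k<m. Re (zc v (Suc k) * zc w (Suc k) * ?w k))"
    unfolding sum_double[of "\<lambda>a. \<Sum>b<2 * m. _ a b"]
  proof (rule sum.cong[OF refl])
    fix k assume "k \<in> {..<m}"
    then have k: "k < m" "k < 2 * m" "k + m < 2 * m" by auto
    have *: "Re (Complex a b * Complex c d * z) = a * (Re z * c - Im z * d) + b * (- Im z * c - Re z * d)"
      for a b c d z by (simp add: algebra_simps)
    show "(\<Sum>b<2 * m. v $ e (Suc k) * kmat p $$ (k, b) * w $ e (Suc b)) +
        (\<Sum>b<2 * m. v $ e (Suc (k + m)) * kmat p $$ (k + m, b) * w $ e (Suc b)) =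
      Re (zc v (Suc k) * zc w (Suc k) * ?w k)"
      unfolding row[OF k(2)] row[OF k(3)] zc_def[of v] zc_def[of w] * using k(1) by simp
  qed
  then show ?thesis
    unfolding kform_def by (simp add: sum.atLeast1_atMost_eq)
qed

text \<open>Diagonal blocks commute, so the determinant is \<open>det (A D - B C)\<close>, a product
  of entries \<open>- |w_k|^2 = - |z_k|^(-4)\<close>; the equation of the hypersurface gives it
  modulus 1.\<close>

lemma abs_det_kmat:
  assumes p: "p \<in> unit_product"
  shows "\<bar>Determinant.det (kmat p)\<bar> = 1"
proof -
  let ?w = "\<lambda>k. 1 / (zc p (Suc k))\<^sup>2"
  have "Determinant.det (kmat p) = Determinant.det
      (mat_diag m (\<lambda>i. Re (?w i)) * mat_diag m (\<lambda>i. - Re (?w i)) -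
       mat_diag m (\<lambda>i. - Im (?w i)) * mat_diag m (\<lambda>i. - Im (?w i)))"
    unfolding kmat_def Let_def
    by (rule det_four_block_mat[of _ m]) (simp_all only: mat_diag_dim mat_diag_diag mult.commute)
  also have "mat_diag m (\<lambda>i. Re (?w i)) * mat_diag m (\<lambda>i. - Re (?w i)) -
       mat_diag m (\<lambda>i. - Im (?w i)) * mat_diag m (\<lambda>i. - Im (?w i)) = mat_diag m (\<lambda>i. - (cmod (?w i))\<^sup>2)"
    unfolding mat_diag_diag cmod_power2
    by (intro eq_matI) (auto simp: mat_diag_def power2_eq_square)
  finally have "\<bar>Determinant.det (kmat p)\<bar> = (\<Prod>i<m. (cmod (?w i))\<^sup>2)"
    by (simp add: det_mat_diag abs_prod)
  also have "\<dots> = (\<Prod>i<m. inverse (((cmod (zc p (Suc i)))\<^sup>2)\<^sup>2))"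
    by (simp add: norm_divide norm_power power_divide inverse_eq_divide)
  also have "\<dots> = inverse ((\<Prod>k=1..m. (cmod (zc p k))\<^sup>2)\<^sup>2)"
    by (simp add: prod.atLeast1_atMost_eq prod_inversef[symmetric] prod_power_distrib)
  also have "\<dots> = 1" using p by (simp add: unit_product_def)
  finally show ?thesis .
qed

text \<open>One factor \<open>z_k\<close> cancels against the square. Hence \<open>C\<close> is
  orthogonal to the tangent space under \<open>kform p\<close>.\<close>

lemma kform_self: "p \<in> unit_product \<Longrightarrow> kform p (c *\<^sub>R p) v = c * logd p v"
  unfolding kform_def logd_def sum_distrib_left
  by (intro sum.cong) (auto simp: unit_product_nonzero power2_eq_square Re_scaleR_divide)

text \<open>The columns of the determinant \<open>\<Theta>\<close>, with the affine normal at the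
  last index \<open>2 * m - 1\<close>.\<close>

definition frame :: "(nat \<Rightarrow> real ^ 'd \<Rightarrow> real ^ 'd) \<Rightarrow> real ^ 'd \<Rightarrow> nat \<Rightarrow> real ^ 'd" where
  "frame Xs p j = (if j < 2 * m - 1 then Xs j p else blaschke p)"

lemma Theta_form_unit_product:
  assumes "p \<in> unit_product" "\<And>j. j < 2 * m - 1 \<Longrightarrow> diff_field unit_product (Xs j)"
  shows "Theta_form e unit_product (\<lambda>x. x) blaschke Xs p = cdet (2 * m) (\<lambda>j i. frame Xs p j $ e (Suc i))"
  unfolding Theta_form_def cdet_def card_d
  by (intro arg_cong[of _ _ Determinant.det] eq_matI) (auto simp: frame_def Dflat_id assms)

text \<open>The Gram determinant of the frame under \<open>kform p\<close> is evaluated twice: by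
  congruence with \<open>kmat p\<close>, and by splitting off the orthogonal vector
  \<open>C\<close>.\<close>

lemma metric_volume_form_unit_product:
  assumes p: "p \<in> unit_product" and Xs: "\<And>j. j < 2 * m - 1 \<Longrightarrow> diff_field unit_product (Xs j)"
  shows "metric_volume_form e unit_product (\<lambda>x. x) blaschke Xs p = Theta_form e unit_product (\<lambda>x. x) blaschke Xs p"
proof -
  define N where "N = 2 * m - 1"
  have N: "2 * m = Suc N" using m_pos by (simp add: N_def)
  let ?H = "Matrix.mat N N (\<lambda>(i, j). second_fundamental_form unit_product (\<lambda>x. x) blaschke (Xs i) (Xs j) p)"
  let ?G = "\<lambda>i j. kform p (frame Xs p i) (frame Xs p j)"
  let ?c = "\<lambda>j i. frame Xs p j $ e (Suc i)"
  let ?s = "blaschke_scale * m"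
  have s: "?s > 0" using blaschke_scale_pos m_pos by simp
  have tan: "Xs j p \<in> tangent_space unit_product p" if "j < N" for j
    using Xs that p by (auto simp: diff_field_def N_def)
  have frame_last: "frame Xs p N = blaschke_scale *\<^sub>R p"
    by (simp only: frame_def N_def blaschke_def less_irrefl if_False)
  have frame_lt: "frame Xs p j = Xs j p" if "j < N" for j
    using that by (simp add: frame_def N_def)
  have h: "second_fundamental_form unit_product (\<lambda>x. x) blaschke (Xs i) (Xs j) p = ?G i j / ?s" if "i < N" "j < N" for i j
    using second_fundamental_form_unit_product[where X = "Xs i" and Y = "Xs j", OF Xs p tan] that
    by (simp add: frame_lt N_def)
  have 0: "?G N j = 0" if "j < N" for j
    unfolding frame_last kform_self[OF p] using tan[OF that] tangent_space_unit_product[OF p]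
    by (simp add: frame_lt[OF that])
  have NN: "?G N N = blaschke_scale * ?s"
    unfolding frame_last kform_self[OF p] logd_self[OF p] ..
  have "Determinant.det (Matrix.mat (2 * m) (2 * m) (\<lambda>(i, j). ?G i j)) = (cdet (2 * m) ?c)\<^sup>2 * Determinant.det (kmat p)"
    unfolding kform_kmat by (rule det_congruence[OF kmat_carrier])
  then have "(cdet (2 * m) ?c)\<^sup>2 * Determinant.det (kmat p) = Determinant.det (Matrix.mat (Suc N) (Suc N) (\<lambda>(i, j). ?G i j))"
    by (simp only: N)
  also have "\<dots> = Determinant.det (Matrix.mat N N (\<lambda>(i, j). ?G i j)) * (blaschke_scale * ?s)"
    using det_bordered[of N ?G, OF 0] by (simp only: NN)
  \<comment> \<open>On tangent vectors \<open>kform p\<close> is \<open>?s\<close> times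
    \<open>h\<close>, so \<open>N\<close> factors \<open>?s\<close> come out of the
    determinant.\<close>
  also have "Matrix.mat N N (\<lambda>(i, j). ?G i j) = ?s \<cdot>\<^sub>m ?H"
    using s by (intro eq_matI) (auto simp: h)
  also have "Determinant.det (?s \<cdot>\<^sub>m ?H) = ?s ^ N * Determinant.det ?H"
    by simp
  finally have "\<bar>(cdet (2 * m) ?c)\<^sup>2 * Determinant.det (kmat p)\<bar> =
      \<bar>?s ^ N * Determinant.det ?H * (blaschke_scale * ?s)\<bar>"
    by (rule arg_cong)
  then have "\<bar>(cdet (2 * m) ?c)\<^sup>2\<bar> = \<bar>?s ^ N * Determinant.det ?H * (blaschke_scale * ?s)\<bar>"
    by (simp only: abs_mult[of _ "Determinant.det (kmat p)"] abs_det_kmat[OF p] mult_1_right)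
  also have "\<dots> = (?s ^ N * (blaschke_scale * ?s)) * \<bar>Determinant.det ?H\<bar>"
    using s blaschke_scale_pos by (simp add: abs_mult)
  \<comment> \<open>The exponents are \<open>N + 2 = 2 m + 1\<close> for the scale and
    \<open>N + 1 = 2 m\<close> for \<open>m\<close>, as in
    \<open>blaschke_scale_power\<close>.\<close>
  also have "?s ^ N * (blaschke_scale * ?s) = blaschke_scale ^ (Suc N + 1) * real m ^ Suc N"
    by (simp add: power_mult_distrib)
  also have "\<dots> = 1" using blaschke_scale_power unfolding N .
  finally have "(cdet (2 * m) ?c)\<^sup>2 = \<bar>Determinant.det ?H\<bar>" by simp
  then have "sqrt \<bar>Determinant.det ?H\<bar> = \<bar>cdet (2 * m) ?c\<bar>"
    by (metis real_sqrt_abs)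
  moreover have "Theta_form e unit_product (\<lambda>x. x) blaschke Xs p = cdet (2 * m) ?c"
    by (rule Theta_form_unit_product[OF p]) (rule Xs)
  \<comment> \<open>The factor \<open>sgn\<close> in the metric volume form restores the sign lost
    by the square root.\<close>
  ultimately show ?thesis
    unfolding metric_volume_form_def card_d N_def[symmetric] by (simp add: sgn_mult_abs)
qed

text \<open>All columns lie in the kernel of \<open>logd p\<close>, hence are orthogonal to the
  nonzero vector \<open>a\<close> that represents \<open>logd p\<close> by the inner
  product.\<close>

lemma cdet_hyperplane:
  assumes p: "p \<in> unit_product" and W: "\<And>j. j < 2 * m \<Longrightarrow> W j \<in> tangent_space unit_product p"
  shows "cdet (2 * m) (\<lambda>j i. W j $ e (Suc i)) = 0"
proof -
  define a where "a = adjoint (logd p) 1"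
  have sum: "(\<Sum>i<2 * m. f (e (Suc i))) = (\<Sum>j\<in>UNIV. f j)" for f :: "'d \<Rightarrow> real"
    using sum.reindex_bij_betw[OF bij_e, of f] sum.atLeast1_atMost_eq[of "\<lambda>i. f (e i)" "2 * m"] by simp
  have a: "(\<Sum>i<2 * m. a $ e (Suc i) * v $ e (Suc i)) = logd p v" for v
    using adjoint_works[OF linear_logd, of v p 1] sum[of "\<lambda>j. a $ j * v $ j"]
    by (simp add: a_def inner_vec_def mult.commute)
  have "logd p p \<noteq> 0"
    using logd_self[OF p, of 1] m_pos by simp
  then obtain i where "i < 2 * m" "a $ e (Suc i) \<noteq> 0"
    using a[of p] by (metis (no_types, lifting) lessThan_iff mult_zero_left sum.neutral)
  moreover have "(\<Sum>i<2 * m. a $ e (Suc i) * W j $ e (Suc i)) = 0" if "j < 2 * m" for j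
    using a W[OF that] by (simp add: tangent_space_unit_product[OF p])
  ultimately show ?thesis
    by (intro cdet_eq_0[of _ "\<lambda>i. a $ e (Suc i)"])
qed

text \<open>By equality of the two volume forms the determinant \<open>\<Theta>\<close> can be
  differentiated column by column. The term of each tangential column matches the one with
  \<open>\<nabla>_X X_k\<close>, and the term of the column \<open>C\<close> vanishes.\<close>

lemma parallel_form_unit_product:
  "parallel_form (2 * m - 1) unit_product (induced_connection unit_product (\<lambda>x. x) blaschke)
     (metric_volume_form e unit_product (\<lambda>x. x) blaschke)"
  unfolding parallel_form_def
proof (intro allI impI ballI)
  fix X Xs p
  assume X: "vector_field unit_product X" and Xs: "\<forall>i<2 * m - 1. vector_field unit_product (Xs i)" and p: "p \<in> unit_product"
  define N where "N = 2 * m - 1"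
  have N: "2 * m = Suc N" using m_pos by (simp add: N_def)
  have frame: "frame Ys q j = (if j < N then Ys j q else blaschke q)" for Ys q j
    by (simp add: frame_def N_def)
  let ?\<omega> = "metric_volume_form e unit_product (\<lambda>x. x) blaschke"
  let ?nab = "induced_connection unit_product (\<lambda>x. x) blaschke"
  let ?c = "\<lambda>q j i. frame Xs q j $ e (Suc i)"
  have Xs': "diff_field unit_product (Xs j)" if "j < N" for j
    using Xs that by (auto simp: N_def intro: vector_field_imp_diff_field)
  have Xp: "X p \<in> tangent_space unit_product p" using X p by (simp add: vector_field_def)
  have "\<forall>j. \<exists>D. j < N \<longrightarrow> (Xs j has_derivative D) (at p within unit_product)"
    using Xs' p unfolding diff_field_def differentiable_def by blast
  then obtain D where D: "\<And>j. j < N \<Longrightarrow> (Xs j has_derivative D j) (at p within unit_product)"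
    by metis
  \<comment> \<open>The last column \<open>blaschke\<close> is linear, hence its own
    derivative.\<close>
  define D' where "D' j = (if j < N then D j else blaschke)" for j
  have D': "((\<lambda>q. frame Xs q j) has_derivative D' j) (at p within unit_product)" for j
    using D[of j] linear_imp_has_derivative[OF linear_blaschke]
    by (auto simp: frame_def D'_def N_def)
  let ?t = "\<lambda>k. cdet (Suc N) ((?c p)(k := \<lambda>i. D' k (X p) $ e (Suc i)))"
  have "((\<lambda>q. cdet (Suc N) (?c q)) has_derivative
      (\<lambda>v. \<Sum>k<Suc N. cdet (Suc N) ((?c p)(k := \<lambda>i. D' k v $ e (Suc i))))) (at p within unit_product)"
    by (rule has_derivative_cdet) (rule bounded_linear.has_derivative[OF bounded_linear_vec_nth D'])
  note der = Dflat_eq[where X = X, OF this Xp]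
  have \<omega>: "?\<omega> Ys q = cdet (Suc N) (\<lambda>j i. frame Ys q j $ e (Suc i))"
    if "q \<in> unit_product" "\<And>j. j < N \<Longrightarrow> diff_field unit_product (Ys j)" for Ys q
    using metric_volume_form_unit_product[of q Ys] Theta_form_unit_product[of q Ys] that unfolding N_def[symmetric] N by simp
  have "Dflat unit_product X (?\<omega> Xs) p = (\<Sum>k<Suc N. ?t k)"
    unfolding der[symmetric] by (rule Dflat_cong[OF p]) (rule \<omega>[OF _ Xs'])
  \<comment> \<open>Here column \<open>C\<close> has become \<open>D_X C = s X\<close>, so every
    column is tangential.\<close>
  moreover have "?t N = 0"
  proof -
    have "(?c p)(N := \<lambda>i. D' N (X p) $ e (Suc i)) =
        (\<lambda>j i. (if j = N then blaschke (X p) else frame Xs p j) $ e (Suc i))"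
      by (auto simp: D'_def)
    moreover have "(if j = N then blaschke (X p) else frame Xs p j) \<in> tangent_space unit_product p"
      if "j < 2 * m" for j
    proof (cases "j = N")
      case True
      with Xp show ?thesis
        by (simp add: tangent_space_unit_product[OF p] blaschke_def[of "X p"] linear_scale[OF linear_logd])
    next
      case False
      with that N have "j < N" by simp
      with False Xs' p show ?thesis by (auto simp: frame_def N_def diff_field_def)
    qed
    ultimately show ?thesis
      using cdet_hyperplane[OF p, of "\<lambda>j. if j = N then blaschke (X p) else frame Xs p j"] by (simp add: N)
  qed
  \<comment> \<open>The connection differs from the flat derivative by a multiple of
    \<open>C\<close>, which is column \<open>N\<close> and can be subtracted.\<close>
  moreover have "?\<omega> (Xs(k := ?nab X (Xs k))) p = ?t k" if k: "k < N" for k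
  proof -
    let ?a = "- (kform p (X p) (Xs k p) / (blaschke_scale * m))"
    have "Dflat unit_product X (Xs k) p = D k (X p)"
      by (rule Dflat_eq[where X = X, OF D[OF k] Xp])
    then have nab: "?nab X (Xs k) p = D k (X p) + ?a *\<^sub>R blaschke p"
      unfolding induced_connection_unit_product[where X = X, OF Xs'[OF k] p Xp] by simp
    have "diff_field unit_product (?nab X (Xs k))"
      using Xs k by (intro diff_field_induced_connection X) (simp add: N_def)
    with Xs' have "?\<omega> (Xs(k := ?nab X (Xs k))) p =
        cdet (Suc N) (\<lambda>j i. frame (Xs(k := ?nab X (Xs k))) p j $ e (Suc i))"
      by (intro \<omega>[OF p]) simp
    also have "(\<lambda>j i. frame (Xs(k := ?nab X (Xs k))) p j $ e (Suc i)) =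
        (?c p)(k := \<lambda>i. D' k (X p) $ e (Suc i) + ?a * ?c p N i)"
      using k by (intro ext) (auto simp: frame D'_def nab)
    also have "cdet (Suc N) \<dots> = ?t k"
      using k by (intro cdet_upd_add_scale) auto
    finally show ?thesis .
  qed
  ultimately show "Dflat unit_product X (?\<omega> Xs) p - (\<Sum>i<2 * m - 1. ?\<omega> (Xs(i := ?nab X (Xs i))) p) = 0"
    unfolding N_def[symmetric] by simp
qed

lemma J_tangent_affine_hypersphere_unit_product: "J_tangent_affine_hypersphere e unit_product (\<lambda>x. x)"
  unfolding J_tangent_affine_hypersphere_def
proof (intro exI[of _ blaschke] conjI ballI)
  have "Blaschke_field e unit_product (\<lambda>x. x) blaschke"
    unfolding Blaschke_field_def card_d
    by (intro conjI transversal_field_unit_product nondegenerate_unit_product parallel_form_unit_product allI impI ballI)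
      (rule metric_volume_form_unit_product, simp_all add: vector_field_imp_diff_field)
  then show "affine_hypersphere_wrt e unit_product (\<lambda>x. x) blaschke"
    unfolding affine_hypersphere_wrt_def
    by (intro conjI hypersurface_immersion_unit_product exI[of _ "- blaschke_scale"] allI impI ballI)
      (simp_all add: shape_operator_unit_product)
  show "complex_structure e (blaschke p) \<in> pushforward unit_product (\<lambda>x. x) p ` tangent_space unit_product p"
    if "p \<in> unit_product" for p
    using complex_structure_tangent[OF that] by (metis image_eqI pushforward_id)
qed

end

section \<open>Regrouping the coordinates of the given equation\<close>

theorem proposition5p8:
  fixes n :: nat and e :: "nat \<Rightarrow> 'd::finite" and M :: "(real ^ 'd) set"
  assumes "bij_betw e {1..2 * n + 2} (UNIV :: 'd set)"
    and "M = {x. (\<Prod>k = 1..n + 1. (x $ e (2 * k - 1))\<^sup>2 + (x $ e (2 * k))\<^sup>2) = 1}"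
  shows "\<exists>(L :: real ^ 'd \<Rightarrow> real ^ 'd) b. linear L \<and> bij L \<and>
           J_tangent_affine_hypersphere e ((\<lambda>x. L x + b) ` M) (\<lambda>x. x)"
proof -
  have "2 * (n + 1) = 2 * n + 2" by simp
  with assms(1) interpret split_coordinates e "n + 1"
    by (intro split_coordinates.intro) (simp only:)
  \<comment> \<open>A permutation of coordinates that makes \<open>x_(2k-1)\<close> and
    \<open>x_(2k)\<close> the real and imaginary parts of \<open>z_k\<close>; the translation
    \<open>b\<close> will be 0.\<close>
  define L where "L x = vc (\<lambda>k. Complex (x $ e (2 * k - 1)) (x $ e (2 * k)))" for x
  have zcL: "zc (L x) k = Complex (x $ e (2 * k - 1)) (x $ e (2 * k))" if "k \<in> {1..n + 1}" for x k
    unfolding L_def using that by (rule zc_vc)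
  have lin: "linear L"
    unfolding L_def by (rule linear_vc_comp) (auto intro!: linearI simp: complex_eq_iff)
  have "inj L"
  proof (rule injI, rule iffD2[OF Finite_Cartesian_Product.vec_eq_iff], rule allI)
    fix x y j assume L: "L x = L y"
    obtain i where i: "i \<in> {1..2 * n + 2}" "j = e i"
      using assms(1) by (metis UNIV_I bij_betw_iff_bijections)
    \<comment> \<open>The index of the pair containing coordinate \<open>i\<close>: both
      \<open>2 * k - 1\<close> and \<open>2 * k\<close> are sent to \<open>k\<close>.\<close>
    define k where "k = (i + 1) div 2"
    have k: "k \<in> {1..n + 1}" "i = 2 * k - 1 \<or> i = 2 * k" using i(1) by (auto simp: k_def)
    from zcL[OF k(1), of x] zcL[OF k(1), of y] L
    have "x $ e (2 * k - 1) = y $ e (2 * k - 1)" "x $ e (2 * k) = y $ e (2 * k)" by auto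
    with k(2) i(2) show "x $ j = y $ j" by auto
  qed
  with lin have bij: "bij L"
    by (simp add: bij_def linear_injective_imp_surjective)
  have "x \<in> M \<longleftrightarrow> L x \<in> unit_product" for x
  proof -
    have "(\<Prod>k=1..n + 1. (cmod (zc (L x) k))\<^sup>2) = (\<Prod>k=1..n + 1. (x $ e (2 * k - 1))\<^sup>2 + (x $ e (2 * k))\<^sup>2)"
      by (rule prod.cong[OF refl]) (simp only: zcL cmod_power2 complex.sel)
    then show ?thesis unfolding assms(2) unit_product_def by (simp only: mem_Collect_eq)
  qed
  then have "(\<lambda>x. L x + 0) ` M = unit_product"
    using bij by (auto simp: bij_def surj_def) (metis image_eqI)
  then show ?thesis
    using lin bij J_tangent_affine_hypersphere_unit_product by (intro exI[of _ L] exI[of _ 0]) simp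
qed

end
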